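(* Let $d\in\mathbb{N}$, $\alpha_1,\dots,\alpha_d\in(0,1]$, and let $a_{ij}\in\mathbb{C}$ ($1\le i\le j\le d$) with $a_{ii}\neq0$ for all $i=1,\dots,d$. Consider the homogeneous upper triangular system $$D_*^{\alpha_i}x_i(t)=\sum_{j=i}^d a_{ij}x_j(t),\qquad 1\le i\le d,\ t>0.$$ (i) Every solution of this system converges to zero as $t\to\infty$ if and only if $$|\arg(a_{kk})|>\frac{\alpha_k\pi}{2}\qquad\text{for all } k\in\{1,\dots,d\}.$$ (ii) If there exists $k\in\{1,\dots,d\}$ such that $|\arg(a_{kk})|<\alpha_k\pi/2$, then there exists some $x_0\in\mathbb{C}^d$ such that the solution of the system that satisfies the initial condition $x(0)=x_0$ is unbounded on $[0,\infty)$.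
   Context: $D_*^{\alpha}$ denotes the Caputo derivative of order $\alpha$. By definition, a solution of the system with initial condition $x(0)=x_0=(x_1^0,\dots,x_d^0)^\top\in\mathbb{C}^d$ is a continuous function $x=(x_1,\dots,x_d)^\top:[0,\infty)\to\mathbb{C}^d$ satisfying $$x_i(t)=x_i^0+\frac{1}{\Gamma(\alpha_i)}\int_0^t(t-s)^{\alpha_i-1}\sum_{j=i}^d a_{ij}x_j(s)\,ds\qquad\text{for all } t\ge0,\ 1\le i\le d.$$ For every $x_0\in\mathbb{C}^d$ there is exactly one such solution. "Every solution" means the solutions for all $x_0\in\mathbb{C}^d$. The argument $\arg$ takes values in $(-\pi,\pi]$. *)

theory Defs
  imports "HOL-Analysis.Analysis"
begin

definition frac_integral :: "real \<Rightarrow> (real \<Rightarrow> complex) \<Rightarrow> real \<Rightarrow> complex" where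
  "frac_integral \<beta> f t =
     (1 / Gamma \<beta>) *\<^sub>R (LINT s:{0..t}|lborel. ((t - s) powr (\<beta> - 1)) *\<^sub>R f s)"

text \<open>
  The index type, a nonempty finite linear order with \<open>d\<close> elements, plays the role of
  \<open>{1, \<dots>, d}\<close>. Entries of \<open>a\<close> strictly below the diagonal do not occur. Functions on the
  half-line are functions on the reals whose values at negative arguments are
  irrelevant. The initial condition \<open>x 0 = x0\<close> is the case \<open>t = 0\<close> of the integral equation.
\<close>

definition is_caputo_solution ::
  "('d \<Rightarrow> real) \<Rightarrow> ('d \<Rightarrow> 'd \<Rightarrow> complex) \<Rightarrow>
   (complex ^ 'd::{finite,linorder}) \<Rightarrow> (real \<Rightarrow> complex ^ 'd::{finite,linorder}) \<Rightarrow> bool"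
where
  "is_caputo_solution \<alpha> a x0 x \<longleftrightarrow>
     continuous_on {0..} x \<and>
     (\<forall>t\<ge>0. \<forall>i. x t $ i =
        x0 $ i + frac_integral (\<alpha> i) (\<lambda>s. \<Sum>j\<in>{i..}. a i j * x s $ j) t)"

end

theory Submission
  imports Defs "HOL-Complex_Analysis.Complex_Analysis"
begin

text \<open>
  The Laplace transform turns the \<open>i\<close>-th equation into
  \<open>(s powr \<alpha> i - a i i) * X i s = s powr (\<alpha> i - 1) * x0 i + (\<Sum>j>i. a i j * X j s)\<close>.

  Instability: take \<open>x0\<close> a unit vector at the largest index \<open>k\<close> violating the condition. Then \<open>X j = 0\<close> for \<open>j > k\<close>
  and \<open>(s powr \<alpha> k - a k k) * X k s = s powr (\<alpha> k - 1)\<close>, on the whole right half-plane by the identity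
  theorem. If \<open>s powr \<alpha> k = a k k\<close> has a solution \<open>s\<close> with positive real part, the left side vanishes
  there but the right side does not, so \<open>x\<close> cannot be bounded. If \<open>s\<close> lies on the imaginary axis,
  approach it horizontally: \<open>x \<longlongrightarrow> 0\<close> would force \<open>\<epsilon> * X k (s + \<epsilon>) \<longlongrightarrow> 0\<close>, and again the left side vanishes.

  Stability: working downwards from the last equation it suffices to treat a scalar equation with
  a forcing term \<open>g \<longlongrightarrow> 0\<close>. If \<open>\<bar>Arg l\<bar> > \<alpha> * pi / 2\<close>, then \<open>1 / (s powr \<alpha> - l)\<close> is the transform of an
  integrable function \<open>r\<close> with total mass \<open>- 1 / l\<close>, given by an inverse Laplace integral along two rays in the
  left half-plane; the solution is \<open>x0\<close> plus the convolution of \<open>r\<close> with \<open>l * x0 + g\<close>, which tends to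
  \<open>x0 - x0 = 0\<close>.
\<close>

section \<open>Convolution on the half-line\<close>

text \<open>Stability asks only for an absolutely integrable resolvent: convolution with such a
  kernel carries limits at infinity to limits, so no decay rate of the couplings from later rows and
  no asymptotics of Mittag-Leffler functions enter. On a vertical line
  \<open>1 / (s powr \<alpha> - l)\<close> decays only like the power - \<alpha> of the modulus,
  with \<alpha> \<le> 1, and is not integrable. Hence the contour is bent to the left, where
  \<open>exp (s * t)\<close> decays; the condition on \<open>Arg l\<close> is what leaves room for
  rays of angle beyond pi / 2 while \<open>s powr \<alpha>\<close> stays away from \<open>l\<close>.

  A solution is only known to be continuous, so a growth bound must precede its transform. For
  instability, boundedness is the assumption to be refuted; for stability, an exponential bound is
  derived from the equation. The equations are transformed at real arguments only, where the damped
  kernel is real and nonnegative; that is enough for injectivity and for analytic continuation.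

  Existence is proved by a contraction, because the negative claims need an actual solution that
  fails to converge or to stay bounded.\<close>

definition conv :: "(real \<Rightarrow> complex) \<Rightarrow> (real \<Rightarrow> complex) \<Rightarrow> real \<Rightarrow> complex" where
  "conv K F t = (LINT s|lborel. K (t - s) * F s)"

text \<open>Cutting off at 0 lets convolutions and transforms be integrals over the whole line,
  where translation invariance and Fubini apply without moving endpoints. For causal factors
  \<open>conv\<close> is the usual integral over \<open>{0..t}\<close>.\<close>

definition causal :: "(real \<Rightarrow> complex) \<Rightarrow> real \<Rightarrow> complex" where
  "causal f t = (if 0 \<le> t then f t else 0)"

definition laplace :: "(real \<Rightarrow> complex) \<Rightarrow> complex \<Rightarrow> complex" where
  "laplace f s = (LINT t|lborel. causal (\<lambda>t. exp (- s * of_real t) * f t) t)"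

text \<open>Applied to functions weighted by \<open>exp (- s * of_real t)\<close>, the second claim
  becomes the convolution theorem \<open>laplace_conv\<close>.\<close>

lemma conv_L1:
  assumes [measurable]: "integrable lborel K" "integrable lborel F"
  shows "integrable lborel (conv K F)"
    and "(LINT t|lborel. conv K F t) = (LINT t|lborel. K t) * (LINT t|lborel. F t)"
proof -
  have [measurable]: "K \<in> borel_measurable borel" "F \<in> borel_measurable borel"
    using assms[THEN borel_measurable_integrable] by simp_all
  have shift: "integrable lborel (\<lambda>t. K (t - s))" for s
    using lborel_integrable_real_affine[OF assms(1), of 1 "-s"] by simp
  have shiftn: "(LINT t|lborel. norm (K (t - s))) = (LINT t|lborel. norm (K t))" for s
    using lborel_integral_real_affine[of 1 "\<lambda>t. norm (K t)" "-s"] by simp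
  have shifti: "(LINT t|lborel. K (t - s)) = (LINT t|lborel. K t)" for s
    using lborel_integral_real_affine[of 1 "\<lambda>t. K t" "-s"] by simp
  have int: "integrable (lborel \<Otimes>\<^sub>M lborel) (case_prod (\<lambda>s t. K (t - s) * F s))"
  proof (rule lborel_pair.Fubini_integrable)
    show "(\<lambda>(s, t). K (t - s) * F s) \<in> borel_measurable (lborel \<Otimes>\<^sub>M lborel)" by measurable
    show "integrable lborel (\<lambda>s. LINT t|lborel. norm (case (s, t) of (s, t) \<Rightarrow> K (t - s) * F s))"
      using assms by (simp add: norm_mult shiftn)
    show "AE s in lborel. integrable lborel (\<lambda>t. case (s, t) of (s, t) \<Rightarrow> K (t - s) * F s)"
      using shift by simp
  qed
  show "integrable lborel (conv K F)"
    using lborel_pair.integrable_snd[OF int] by (simp add: conv_def[abs_def])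
  show "(LINT t|lborel. conv K F t) = (LINT t|lborel. K t) * (LINT t|lborel. F t)"
    using lborel_pair.Fubini_integral[OF int] by (simp add: conv_def shifti)
qed

lemma conv_flip: "conv K F t = (LINT u|lborel. K u * F (t - u))"
  unfolding conv_def
  using lborel_integral_real_affine[of "-1" "\<lambda>s. K (t - s) * F s" t] by simp

lemma conv_integrand_integrable:
  fixes K F :: "real \<Rightarrow> complex"
  assumes K: "integrable lborel K" and F[measurable]: "F \<in> borel_measurable borel"
    and B: "\<And>t. norm (F t) \<le> B"
  shows "integrable lborel (\<lambda>u. K u * F (t - u))"
proof (rule Bochner_Integration.integrable_bound)
  have [measurable]: "K \<in> borel_measurable borel"
    using K[THEN borel_measurable_integrable] by simp
  show "integrable lborel (\<lambda>u. norm (K u) * B)" using K by simp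
  show "(\<lambda>u. K u * F (t - u)) \<in> borel_measurable lborel" by measurable
  have "B \<ge> 0" using B[of 0] norm_ge_zero order_trans by blast
  then show "AE u in lborel. norm (K u * F (t - u)) \<le> norm (norm (K u) * B)"
    by (auto simp: norm_mult intro!: mult_left_mono B)
qed

lemma conv_integrand_integrable':
  fixes K F :: "real \<Rightarrow> complex"
  assumes K: "integrable lborel K" and F[measurable]: "F \<in> borel_measurable borel"
    and B: "\<And>t. norm (F t) \<le> B"
  shows "integrable lborel (\<lambda>s. K (t - s) * F s)"
  using lborel_integrable_real_affine[OF conv_integrand_integrable[OF assms, of t], of "-1" t] by simp

lemma conv_bound:
  assumes K: "integrable lborel K" and F: "F \<in> borel_measurable borel"
    and B: "\<And>t. norm (F t) \<le> B"
  shows "norm (conv K F t) \<le> (LINT u|lborel. norm (K u)) * B"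
proof -
  have "norm (conv K F t) \<le> (LINT u|lborel. norm (K u) * B)"
    unfolding conv_flip
    by (rule Bochner_Integration.integral_norm_bound_integral[OF conv_integrand_integrable[OF assms]])
       (use K in \<open>auto simp: norm_mult intro!: mult_left_mono B\<close>)
  then show ?thesis by simp
qed

text \<open>Common source of continuity and of the limit at infinity: in the first case
  \<open>G u\<close> is \<open>F (t - u)\<close>, in the second it is constant. Convergence is asked
  only almost everywhere because a causal function may jump at 0.\<close>

lemma conv_dominated:
  assumes K: "integrable lborel K" and F[measurable]: "F \<in> borel_measurable borel"
    and B: "\<And>t. norm (F t) \<le> B"
    and lim: "AE u in lborel. (\<lambda>n. F (X n - u)) \<longlonglongrightarrow> G u"
    and [measurable]: "G \<in> borel_measurable borel"
  shows "(\<lambda>n. conv K F (X n)) \<longlonglongrightarrow> (LINT u|lborel. K u * G u)"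
  unfolding conv_flip
proof (rule integral_dominated_convergence[where w="\<lambda>u. norm (K u) * B"])
  have [measurable]: "K \<in> borel_measurable borel"
    using K[THEN borel_measurable_integrable] by simp
  show "(\<lambda>u. K u * G u) \<in> borel_measurable lborel" by measurable
  show "(\<lambda>u. K u * F (X n - u)) \<in> borel_measurable lborel" for n by measurable
  show "integrable lborel (\<lambda>u. norm (K u) * B)" using K by simp
  show "AE u in lborel. (\<lambda>n. K u * F (X n - u)) \<longlonglongrightarrow> K u * G u"
    using lim by eventually_elim (intro tendsto_intros)
  show "AE u in lborel. norm (K u * F (X n - u)) \<le> norm (K u) * B" for n
    by (auto simp: norm_mult intro!: mult_left_mono B)
qed

text \<open>The possible jump of \<open>F\<close> at 0 is met only at \<open>u = t\<close>, a null
  set.\<close>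

lemma conv_continuous:
  assumes K: "integrable lborel K" and F[measurable]: "F \<in> borel_measurable borel"
    and B: "\<And>t. norm (F t) \<le> B" and cont: "\<And>t. t \<noteq> 0 \<Longrightarrow> isCont F t"
  shows "isCont (conv K F) t"
proof -
  have "(\<lambda>n. conv K F (X n)) \<longlonglongrightarrow> conv K F t" if X: "X \<longlonglongrightarrow> t" for X
    unfolding conv_flip[of K F t]
  proof (rule conv_dominated[OF K F B])
    have "(\<lambda>n. F (X n - u)) \<longlonglongrightarrow> F (t - u)" if "u \<noteq> t" for u
      by (rule isCont_tendsto_compose[OF cont]) (use X that in \<open>auto intro!: tendsto_intros\<close>)
    then show "AE u in lborel. (\<lambda>n. F (X n - u)) \<longlonglongrightarrow> F (t - u)"
      using AE_lborel_singleton[of t] by auto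
  qed measurable
  then show ?thesis
    unfolding continuous_at_sequentially by (auto simp: o_def)
qed

text \<open>Every translate \<open>F (X n - u)\<close> tends to \<open>L\<close>, so dominated
  convergence gives the limit without any rate for \<open>K\<close> or \<open>F\<close>.\<close>

lemma conv_tendsto_at_top:
  assumes K: "integrable lborel K" and F[measurable]: "F \<in> borel_measurable borel"
    and B: "\<And>t. norm (F t) \<le> B" and lim: "(F \<longlongrightarrow> L) at_top"
  shows "(conv K F \<longlongrightarrow> (LINT u|lborel. K u) * L) at_top"
proof (rule tendsto_at_topI_sequentially)
  fix X :: "nat \<Rightarrow> real" assume X: "filterlim X at_top sequentially"
  have "filterlim (\<lambda>n. X n - u) at_top sequentially" for u
    using filterlim_tendsto_add_at_top[OF tendsto_const[of "-u"] X] by simp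
  then have "(\<lambda>n. F (X n - u)) \<longlonglongrightarrow> L" for u
    by (rule filterlim_compose[OF lim])
  then have "(\<lambda>n. conv K F (X n)) \<longlonglongrightarrow> (LINT u|lborel. K u * L)"
    by (intro conv_dominated[OF K F B]) auto
  then show "(\<lambda>n. conv K F (X n)) \<longlonglongrightarrow> (LINT u|lborel. K u) * L" by simp
qed

lemma causal_measurable:
  assumes "continuous_on {0..} f"
  shows "causal f \<in> borel_measurable borel"
proof -
  have "(\<lambda>t. if t \<in> {0..} then f t else 0) \<in> borel_measurable borel"
    using assms by (intro borel_measurable_continuous_on_if) auto
  then show ?thesis by (simp add: causal_def[abs_def])
qed

lemma causal_isCont:
  assumes "continuous_on {0..} f" "t \<noteq> 0"
  shows "isCont (causal f) t"
proof (cases "t > 0")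
  case True
  have "continuous_on {0<..} f" by (rule continuous_on_subset[OF assms(1)]) auto
  then have "isCont f t" using True by (auto simp: continuous_on_eq_continuous_at)
  moreover have "eventually (\<lambda>s. f s = causal f s) (nhds t)"
    using eventually_nhds_in_open[of "{0<..}" t] True
    by (auto elim!: eventually_mono simp: causal_def)
  ultimately show ?thesis using isCont_cong by blast
next
  case False
  have "eventually (\<lambda>s. 0 = causal f s) (nhds t)"
    using eventually_nhds_in_open[of "{..<0}" t] False assms(2)
    by (auto elim!: eventually_mono simp: causal_def)
  then show ?thesis using isCont_cong[of "\<lambda>_. 0" "causal f" t] by auto
qed

lemma causal_bound: "(\<And>t. 0 \<le> t \<Longrightarrow> norm (f t) \<le> B) \<Longrightarrow> 0 \<le> B \<Longrightarrow> norm (causal f t) \<le> B"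
  by (simp add: causal_def)

lemma causal_tendsto: "(f \<longlongrightarrow> L) at_top \<Longrightarrow> (causal f \<longlongrightarrow> L) at_top"
  by (erule Lim_transform_eventually) (auto simp: causal_def eventually_at_top_linorder intro!: exI[of _ 0])

text \<open>Damping by \<open>exp (- M * u)\<close> makes the kernel integrable, and its mass \<open>M powr - \<beta>\<close> is small for large
  \<open>M\<close>: this yields both the contraction for existence and the exponential growth bound.\<close>

definition frac_kernel :: "real \<Rightarrow> real \<Rightarrow> real \<Rightarrow> complex" where
  "frac_kernel \<beta> M = causal (\<lambda>u. of_real (u powr (\<beta> - 1) * exp (- M * u) / Gamma \<beta>))"

lemma gamma_bochner:
  assumes b: "0 < (\<beta>::real)"
  shows "has_bochner_integral lborel (\<lambda>t. indicator {0..} t * t powr (\<beta> - 1) * exp (-t)) (Gamma \<beta>)"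
proof (rule has_bochner_integral_nn_integral)
  show "(\<integral>\<^sup>+ t. ennreal (indicator {0..} t * t powr (\<beta> - 1) * exp (-t)) \<partial>lborel) = ennreal (Gamma \<beta>)"
    using Gamma_conv_nn_integral_real[OF b] by (simp add: exp_minus divide_inverse)
qed (use b in auto)

text \<open>Euler's integral for \<open>Gamma \<beta>\<close> after substituting
  \<open>M * t\<close>; the factor \<open>M powr (1 - \<beta>) / Gamma \<beta>\<close> normalises
  the result to the kernel. The kernel is real and nonnegative, so its mass and its norm
  agree.\<close>

lemma frac_kernel_bochner:
  assumes b: "0 < \<beta>" and M: "0 < M"
  shows "has_bochner_integral lborel (\<lambda>t. norm (frac_kernel \<beta> M t)) (M powr (-\<beta>))"
    and "has_bochner_integral lborel (frac_kernel \<beta> M) (of_real (M powr (-\<beta>)))"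
proof -
  have G: "Gamma \<beta> > 0" using b by (simp add: Gamma_real_pos)
  have "has_bochner_integral lborel
     (\<lambda>t. indicator {0..} (0 + M*t) * (0 + M*t) powr (\<beta> - 1) * exp (-(0+M*t))) (Gamma \<beta> /\<^sub>R \<bar>M\<bar>)"
    using lborel_has_bochner_integral_real_affine_iff[of M _ "Gamma \<beta>" 0] gamma_bochner[OF b] M by simp
  then have "has_bochner_integral lborel
     (\<lambda>t. (indicator {0..} (0 + M*t) * (0 + M*t) powr (\<beta> - 1) * exp (-(0+M*t))) * (M powr (1-\<beta>) / Gamma \<beta>))
     ((Gamma \<beta> /\<^sub>R \<bar>M\<bar>) * (M powr (1-\<beta>) / Gamma \<beta>))"
    by (rule has_bochner_integral_mult_left)
  moreover have "(indicator {0..} (0 + M*t) * (0 + M*t) powr (\<beta> - 1) * exp (-(0+M*t))) * (M powr (1-\<beta>) / Gamma \<beta>)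
      = norm (frac_kernel \<beta> M t)" for t
  proof -
    have "M powr (\<beta> - 1) * M powr (1 - \<beta>) = 1" using M by (simp add: powr_add[symmetric])
    then show ?thesis
      using M G by (auto simp: frac_kernel_def causal_def indicator_def norm_mult norm_divide powr_mult zero_le_mult_iff field_simps)
  qed
  moreover have "(Gamma \<beta> /\<^sub>R \<bar>M\<bar>) * (M powr (1-\<beta>) / Gamma \<beta>) = M powr (-\<beta>)"
    using G M by (simp add: powr_diff powr_minus field_simps)
  ultimately show *: "has_bochner_integral lborel (\<lambda>t. norm (frac_kernel \<beta> M t)) (M powr (-\<beta>))" by simp
  have "of_real (norm (frac_kernel \<beta> M t)) = frac_kernel \<beta> M t" for t
    using G by (auto simp: frac_kernel_def causal_def norm_mult norm_divide)
  then show "has_bochner_integral lborel (frac_kernel \<beta> M) (of_real (M powr (-\<beta>)))"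
    using has_bochner_integral_of_real[OF *, where 'a=complex] by simp
qed

lemma frac_kernel_integrable: "0 < \<beta> \<Longrightarrow> 0 < M \<Longrightarrow> integrable lborel (frac_kernel \<beta> M)"
  and frac_kernel_integral: "0 < \<beta> \<Longrightarrow> 0 < M \<Longrightarrow> (LINT t|lborel. frac_kernel \<beta> M t) = of_real (M powr (-\<beta>))"
  and frac_kernel_norm_integral: "0 < \<beta> \<Longrightarrow> 0 < M \<Longrightarrow> (LINT t|lborel. norm (frac_kernel \<beta> M t)) = M powr (-\<beta>)"
  using frac_kernel_bochner[of \<beta> M] by (auto simp: has_bochner_integral_iff)

text \<open>Because \<open>exp (- M * t)\<close> splits into
  \<open>exp (- M * (t - s)) * exp (- M * s)\<close>, damping a fractional integral means damping
  its kernel and its argument. The two integrands agree pointwise.\<close>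

lemma frac_integral_conv:
  "of_real (exp (- M * t)) * frac_integral \<beta> f t
    = conv (frac_kernel \<beta> M) (causal (\<lambda>s. of_real (exp (- M * s)) * f s)) t"
proof -
  have "frac_integral \<beta> f t = (LINT s|lborel. (1 / Gamma \<beta>) *\<^sub>R (indicator {0..t} s *\<^sub>R ((t - s) powr (\<beta> - 1)) *\<^sub>R f s))"
    unfolding frac_integral_def set_lebesgue_integral_def by (rule integral_scaleR_right[symmetric])
  then have "of_real (exp (- M * t)) * frac_integral \<beta> f t = (LINT s|lborel. of_real (exp (- M * t)) * ((1 / Gamma \<beta>) *\<^sub>R (indicator {0..t} s *\<^sub>R ((t - s) powr (\<beta> - 1)) *\<^sub>R f s)))"
    by (simp only: integral_mult_right_zero)
  also have "\<dots> = conv (frac_kernel \<beta> M) (causal (\<lambda>s. of_real (exp (- M * s)) * f s)) t"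
    unfolding conv_def
  proof (rule Bochner_Integration.integral_cong)
    fix s
    have "exp (- M * t) = exp (- M * (t - s)) * exp (- M * s)"
      by (simp add: exp_add[symmetric] algebra_simps)
    then show "of_real (exp (- M * t)) * ((1 / Gamma \<beta>) *\<^sub>R (indicator {0..t} s *\<^sub>R ((t - s) powr (\<beta> - 1)) *\<^sub>R f s))
       = frac_kernel \<beta> M (t - s) * causal (\<lambda>s. of_real (exp (- M * s)) * f s) s"
      by (auto simp: frac_kernel_def causal_def indicator_def scaleR_conv_of_real)
  qed simp
  finally show ?thesis .
qed

section \<open>The Laplace transform\<close>

lemma causal_exp_integrable:
  assumes "Re c < 0"
  shows "integrable lborel (causal (\<lambda>t. exp (c * of_real t)))"
proof (rule Bochner_Integration.integrable_bound)
  show "integrable lborel (frac_kernel 1 (- Re c))" using assms by (intro frac_kernel_integrable) auto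
  show "causal (\<lambda>t. exp (c * of_real t)) \<in> borel_measurable lborel"
    using causal_measurable[of "\<lambda>t. exp (c * of_real t)"] by (simp add: continuous_intros)
  \<comment> \<open>The value \<open>0 powr 0 = 0\<close> makes the kernel vanish at 0, so the
    comparison fails at that single point.\<close>
  show "AE t in lborel. norm (causal (\<lambda>t. exp (c * of_real t)) t) \<le> norm (frac_kernel 1 (- Re c) t)"
    using AE_lborel_singleton[of "0::real"] by eventually_elim (auto simp: causal_def frac_kernel_def)
qed

lemma causal_exp_integral:
  assumes c: "Re c < 0"
  shows "(LINT t|lborel. causal (\<lambda>t. exp (c * of_real t)) t) = - 1 / c"
proof -
  have c0: "c \<noteq> 0" using c by auto
  have 1: "((\<lambda>t. exp (c * complex_of_real t) / c) has_vector_derivative exp (c * complex_of_real t)) (at t)" for t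
    by (rule has_vector_derivative_real_field) (use c0 in \<open>auto intro!: derivative_eq_intros\<close>)
  have si: "set_integrable lborel (einterval 0 \<infinity>) (\<lambda>t. exp (c * complex_of_real t))"
    unfolding set_integrable_def
    by (rule Bochner_Integration.integrable_bound[OF causal_exp_integrable[OF c]])
      (auto simp: causal_def indicator_def einterval_def)
  have "(LBINT t=0..\<infinity>. exp (c * complex_of_real t)) = 0 - exp (c * complex_of_real 0) / c"
  proof (rule interval_integral_FTC_integrable[where F="\<lambda>t. exp (c * complex_of_real t) / c"])
    have "((\<lambda>t. exp (c * complex_of_real t) / c) \<longlongrightarrow> exp (c * complex_of_real 0) / c) (at_right 0)"
      by (intro tendsto_intros c0)
    then show "(((\<lambda>t. exp (c * complex_of_real t) / c) \<circ> real_of_ereal) \<longlongrightarrow> exp (c * complex_of_real 0) / c) (at_right 0)"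
      using ereal_tendsto_simps1(2)[of "\<lambda>t. exp (c * complex_of_real t) / c" "exp (c * complex_of_real 0) / c" 0]
      by (simp only: zero_ereal_def)
    have "((\<lambda>t. exp (Re c * t)) \<longlongrightarrow> 0) at_top"
      using c by real_asymp
    then have "((\<lambda>t. norm (exp (c * complex_of_real t))) \<longlongrightarrow> 0) at_top" by simp
    then have "((\<lambda>t. exp (c * complex_of_real t)) \<longlongrightarrow> 0) at_top" by (rule tendsto_norm_zero_cancel)
    then have "((\<lambda>t. exp (c * complex_of_real t) / c) \<longlongrightarrow> 0) at_top"
      using tendsto_divide_zero by blast
    then show "(((\<lambda>t. exp (c * complex_of_real t) / c) \<circ> real_of_ereal) \<longlongrightarrow> 0) (at_left \<infinity>)"
      by (simp add: ereal_tendsto_simps1)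
  qed (use 1 si in \<open>auto intro!: continuous_intros\<close>)
  also have "(LBINT t=0..\<infinity>. exp (c * complex_of_real t)) = (LINT t|lborel. causal (\<lambda>t. exp (c * of_real t)) t)"
    unfolding zero_ereal_def interval_integral_to_infinity_eq set_lebesgue_integral_def
    by (rule integral_cong_AE)
      (use AE_lborel_singleton[of "0::real"] causal_exp_integrable[OF c] in
        \<open>auto simp: causal_def indicator_def elim!: eventually_mono\<close>)
  finally show ?thesis by simp
qed

lemma laplace_integrable:
  assumes f: "continuous_on {0..} f" and B: "\<And>t. 0 \<le> t \<Longrightarrow> norm (f t) \<le> C * exp (M * t)"
    and s: "M < Re s"
  shows "integrable lborel (causal (\<lambda>t. exp (- s * of_real t) * f t))"
proof (rule Bochner_Integration.integrable_bound)
  show "integrable lborel (\<lambda>t. of_real C * causal (\<lambda>t. exp (of_real (M - Re s) * of_real t)) t)"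
    using s by (intro integrable_mult_right causal_exp_integrable) auto
  show "causal (\<lambda>t. exp (- s * of_real t) * f t) \<in> borel_measurable lborel"
    using causal_measurable[of "\<lambda>t. exp (- s * of_real t) * f t"] f by (simp add: continuous_intros)
  have C: "C \<ge> 0" using B[of 0] order_trans[OF norm_ge_zero, of "f 0" C] by simp
  have "norm (exp (- s * of_real t) * f t) \<le> C * exp ((M - Re s) * t)" if "0 \<le> t" for t
  proof -
    have "norm (exp (- s * of_real t) * f t) \<le> exp (- Re s * t) * (C * exp (M * t))"
      unfolding norm_mult using B[OF that] by (intro mult_mono) auto
    then show ?thesis by (simp add: exp_add[symmetric] algebra_simps)
  qed
  then show "AE t in lborel. norm (causal (\<lambda>t. exp (- s * of_real t) * f t) t)
     \<le> norm (of_real C * causal (\<lambda>t. exp (of_real (M - Re s) * of_real t)) t)"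
    using C by (auto simp: causal_def norm_mult)
qed

lemma laplace_add:
  assumes "integrable lborel (causal (\<lambda>t. exp (- s * of_real t) * f t))"
    and "integrable lborel (causal (\<lambda>t. exp (- s * of_real t) * g t))"
  shows "laplace (\<lambda>t. f t + g t) s = laplace f s + laplace g s"
proof -
  have "causal (\<lambda>t. exp (- s * of_real t) * (f t + g t)) =
     (\<lambda>t. causal (\<lambda>t. exp (- s * of_real t) * f t) t + causal (\<lambda>t. exp (- s * of_real t) * g t) t)"
    by (auto simp: causal_def algebra_simps)
  then show ?thesis unfolding laplace_def using assms by simp
qed

lemma laplace_cmult: "laplace (\<lambda>t. c * f t) s = c * laplace f s"
proof -
  have "causal (\<lambda>t. exp (- s * of_real t) * (c * f t)) = (\<lambda>t. c * causal (\<lambda>t. exp (- s * of_real t) * f t) t)"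
    by (auto simp: causal_def)
  then show ?thesis unfolding laplace_def by simp
qed

lemma laplace_sum:
  assumes "\<And>j. j \<in> J \<Longrightarrow> integrable lborel (causal (\<lambda>t. exp (- s * of_real t) * f j t))"
  shows "laplace (\<lambda>t. \<Sum>j\<in>J. f j t) s = (\<Sum>j\<in>J. laplace (f j) s)"
proof -
  have "causal (\<lambda>t. exp (- s * of_real t) * (\<Sum>j\<in>J. f j t)) = (\<lambda>t. \<Sum>j\<in>J. causal (\<lambda>t. exp (- s * of_real t) * f j t) t)"
    by (auto simp: causal_def sum_distrib_left)
  then show ?thesis unfolding laplace_def using assms by simp
qed

lemma laplace_const: "0 < Re s \<Longrightarrow> laplace (\<lambda>_. c) s = c / s"
  using laplace_cmult[of c "\<lambda>_. 1" s] causal_exp_integral[of "-s"] by (simp add: laplace_def divide_inverse)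

lemma laplace_cong: "(\<And>t. 0 \<le> t \<Longrightarrow> f t = g t) \<Longrightarrow> laplace f s = laplace g s"
  unfolding laplace_def by (rule Bochner_Integration.integral_cong) (auto simp: causal_def)

lemma laplace_conv:
  assumes "integrable lborel (causal (\<lambda>t. exp (- s * of_real t) * k t))"
    and "integrable lborel (causal (\<lambda>t. exp (- s * of_real t) * f t))"
  shows "laplace (conv (causal k) (causal f)) s = laplace k s * laplace f s"
proof -
  have "causal (\<lambda>t. exp (- s * of_real t) * conv (causal k) (causal f) t) t
     = conv (causal (\<lambda>t. exp (- s * of_real t) * k t)) (causal (\<lambda>t. exp (- s * of_real t) * f t)) t" for t
  proof (cases "0 \<le> t")
    case True
    have *: "exp (- s * of_real t) = exp (- s * of_real (t - u)) * exp (- s * of_real u)" for u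
      by (simp add: exp_add[symmetric] algebra_simps)
    have "exp (- s * of_real t) * conv (causal k) (causal f) t
        = (LINT u|lborel. exp (- s * of_real t) * (causal k (t - u) * causal f u))"
      by (simp add: conv_def)
    also have "\<dots> = conv (causal (\<lambda>t. exp (- s * of_real t) * k t)) (causal (\<lambda>t. exp (- s * of_real t) * f t)) t"
      unfolding conv_def
    proof (rule Bochner_Integration.integral_cong)
      fix u
      show "exp (- s * of_real t) * (causal k (t - u) * causal f u) =
        causal (\<lambda>t. exp (- s * of_real t) * k t) (t - u) * causal (\<lambda>t. exp (- s * of_real t) * f t) u"
        by (subst *[of u]) (simp add: causal_def)
    qed simp
    finally show ?thesis using True by (simp add: causal_def)
  next
    case False
    then have "causal (\<lambda>t. exp (- s * of_real t) * k t) (t - u) * causal (\<lambda>t. exp (- s * of_real t) * f t) u = 0" for u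
      by (auto simp: causal_def)
    then show ?thesis using False unfolding conv_def by (simp only:) (simp add: causal_def)
  qed
  then have "causal (\<lambda>t. exp (- s * of_real t) * conv (causal k) (causal f) t)
     = conv (causal (\<lambda>t. exp (- s * of_real t) * k t)) (causal (\<lambda>t. exp (- s * of_real t) * f t))"
    by (rule ext)
  then show ?thesis
    unfolding laplace_def using conv_L1(2)[OF assms] by (simp only:)
qed

text \<open>Real arguments suffice for what follows: \<open>laplace_unique\<close> looks only at
  these, and \<open>axis_solution_laplace\<close> reaches the right half-plane from them by analytic
  continuation.\<close>

lemma laplace_frac_integral:
  assumes b: "0 < \<beta>" and M: "0 < M"
    and f: "integrable lborel (causal (\<lambda>t. exp (- of_real M * of_real t) * f t))"
  shows "laplace (frac_integral \<beta> f) (of_real M) = of_real (M powr - \<beta>) * laplace f (of_real M)"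
    and "integrable lborel (causal (\<lambda>t. exp (- of_real M * of_real t) * frac_integral \<beta> f t))"
proof -
  have E: "exp (- of_real M * of_real t) = complex_of_real (exp (- M * t))" for t
    by (metis exp_of_real of_real_minus of_real_mult)
  \<comment> \<open>For negative \<open>t\<close> the range \<open>{0..t}\<close> is empty and the
    fractional integral is 0, so the cut-off changes nothing.\<close>
  have "causal (\<lambda>t. exp (- of_real M * of_real t) * frac_integral \<beta> f t) t = exp (- of_real M * of_real t) * frac_integral \<beta> f t" for t
    by (simp add: causal_def frac_integral_def set_lebesgue_integral_def)
  then have "causal (\<lambda>t. exp (- of_real M * of_real t) * frac_integral \<beta> f t) =
    conv (frac_kernel \<beta> M) (causal (\<lambda>s. exp (- of_real M * of_real s) * f s))"
    unfolding E frac_integral_conv by auto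
  then show "laplace (frac_integral \<beta> f) (of_real M) = of_real (M powr - \<beta>) * laplace f (of_real M)"
    and "integrable lborel (causal (\<lambda>t. exp (- of_real M * of_real t) * frac_integral \<beta> f t))"
    unfolding laplace_def
    using conv_L1[OF frac_kernel_integrable[OF b M] f] frac_kernel_integral[OF b M] by simp_all
qed

text \<open>With \<open>u = exp (- t)\<close> this becomes a moment problem on \<open>[0, 1]\<close>, where polynomials are dense.\<close>

lemma moments_zero_imp_zero:
  fixes h :: "real \<Rightarrow> real"
  assumes h: "continuous_on {0..} h" and B: "\<And>t. 0 \<le> t \<Longrightarrow> \<bar>h t\<bar> \<le> C * exp (- t)"
    and mom: "\<And>n::nat. (LINT t|lborel. indicator {0..} t * (exp (- t) ^ n * h t)) = 0"
    and t: "0 \<le> t"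
  shows "h t = 0"
proof -
  \<comment> \<open>This is \<open>h\<close> in the variable \<open>u = exp (- t)\<close>. The value
    0 at \<open>u = 0\<close> is its limit, because the assumed decay of \<open>h\<close> turns into
    the bound \<open>C * u\<close>.\<close>
  define \<phi> where "\<phi> u = (if u \<le> 0 then 0 else h (- ln u))" for u
  have \<phi>B: "\<bar>\<phi> u\<bar> \<le> C * u" if "0 \<le> u" "u \<le> 1" for u
    using B[of "- ln u"] that by (cases "u = 0") (auto simp: \<phi>_def)
  have "continuous (at x within {0..1}) \<phi>" if x: "x \<in> {0..1}" for x
  proof (cases "x = 0")
    case True
    have "(\<phi> \<longlongrightarrow> 0) (at 0 within {0..1})"
    proof (rule Lim_null_comparison)
      show "eventually (\<lambda>u. norm (\<phi> u) \<le> C * u) (at 0 within {0..1})"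
        using \<phi>B by (auto simp: eventually_at_filter)
      show "((\<lambda>u. C * u) \<longlongrightarrow> 0) (at 0 within {0..1})"
        by (auto intro!: tendsto_eq_intros)
    qed
    then show ?thesis using True by (simp add: continuous_within \<phi>_def)
  next
    case False
    have "continuous_on {0<..1} (\<lambda>u. h (- ln u))"
      by (rule continuous_on_compose2[OF h]) (auto intro!: continuous_intros)
    then have "continuous_on {0<..1} \<phi>"
      by (rule continuous_on_eq) (auto simp: \<phi>_def)
    then have "continuous (at x within {0<..1}) \<phi>"
      using x False by (auto simp: continuous_on_eq_continuous_within)
    moreover have "at x within {0..1} = at x within {0<..1}"
      by (rule at_within_nhd[of _ "{0<..}"]) (use x False in auto)
    ultimately show ?thesis by simp
  qed
  then have \<phi>c: "continuous_on {0..1} \<phi>" by (simp add: continuous_on_eq_continuous_within)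
  define H where "H t = indicator {0..} t * h t" for t
  have Hm[measurable]: "H \<in> borel_measurable borel"
  proof -
    have "(\<lambda>t. if t \<in> {0..} then h t else 0) \<in> borel_measurable borel"
      using h by (intro borel_measurable_continuous_on_if) auto
    also have "(\<lambda>t. if t \<in> {0..} then h t else 0) = H" by (auto simp: H_def fun_eq_iff split: split_indicator)
    finally show ?thesis .
  qed
  have C0: "C \<ge> 0" using B[of 0] by simp
  have ei: "integrable lborel (\<lambda>t. C * norm (causal (\<lambda>t. exp (-1 * of_real t)) t))"
    by (intro integrable_mult_right integrable_norm causal_exp_integrable) auto
  have Hb: "\<bar>H t\<bar> \<le> C * norm (causal (\<lambda>t. exp (-1 * of_real t)) t)" for t
    using B[of t] by (auto simp: H_def causal_def)
  have Hi: "integrable lborel H"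
    by (rule Bochner_Integration.integrable_bound[OF ei]) (use Hb C0 in auto)
  have pow: "integrable lborel (\<lambda>t. exp (-t) ^ n * H t)" for n
  proof (rule Bochner_Integration.integrable_bound[OF Hi])
    show "AE t in lborel. norm (exp (-t) ^ n * H t) \<le> norm (H t)"
    proof (rule AE_I2)
      fix t :: real
      show "norm (exp (-t) ^ n * H t) \<le> norm (H t)"
        by (auto simp: H_def indicator_def abs_mult power_le_one intro!: mult_left_le_one_le)
    qed
  qed measurable
  have mom': "(LINT t|lborel. exp (- t) ^ n * H t) = 0" for n
    using mom[of n] by (simp add: H_def mult.left_commute)
  have Hsq: "H t * H t = \<phi> (exp (-t)) * H t" for t
    by (cases "0 \<le> t") (auto simp: H_def \<phi>_def)
  have \<phi>m: "(\<lambda>t. \<phi> (exp (-t)) * H t) \<in> borel_measurable borel"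
    unfolding Hsq[symmetric] by measurable
  \<comment> \<open>One factor of the square is \<open>\<phi> (exp (- t))\<close>. A uniformly close
    polynomial in \<open>exp (- t)\<close> put in its place gives integral 0 by the moment
    condition, so only the approximation error remains.\<close>
  have bound: "norm (LINT t|lborel. H t * H t) \<le> e * (LINT t|lborel. norm (H t))" if e: "e > 0" for e
  proof -
    obtain p where p: "real_polynomial_function p" "\<And>u. u \<in> {0..1} \<Longrightarrow> \<bar>\<phi> u - p u\<bar> < e"
      using Stone_Weierstrass_real_polynomial_function[OF compact_Icc \<phi>c e] by blast
    then obtain a n where pn: "p = (\<lambda>x. \<Sum>i\<le>n. a i * x ^ i)"
      by (auto simp: real_polynomial_function_iff_sum)
    have pi: "integrable lborel (\<lambda>t. p (exp (-t)) * H t)"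
      unfolding pn sum_distrib_right mult.assoc
      by (intro Bochner_Integration.integrable_sum integrable_mult_right pow)
    have p0: "(LINT t|lborel. p (exp (-t)) * H t) = 0"
      unfolding pn sum_distrib_right mult.assoc
      using pow by (subst Bochner_Integration.integral_sum) (simp_all add: mom')
    have d: "norm (\<phi> (exp (-t)) * H t - p (exp (-t)) * H t) \<le> e * norm (H t)" for t
    proof (cases "0 \<le> t")
      case True
      then have "\<bar>\<phi> (exp (-t)) - p (exp (-t))\<bar> \<le> e" using p(2)[of "exp (-t)"] by simp
      then have "\<bar>\<phi> (exp (-t)) - p (exp (-t))\<bar> * \<bar>H t\<bar> \<le> e * \<bar>H t\<bar>" by (rule mult_right_mono) simp
      then show ?thesis by (simp add: abs_mult[symmetric] left_diff_distrib)
    qed (simp add: H_def)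
    have di: "integrable lborel (\<lambda>t. \<phi> (exp (-t)) * H t - p (exp (-t)) * H t)"
      by (rule Bochner_Integration.integrable_bound[where f="\<lambda>t. e * norm (H t)"])
         (use d Hi \<phi>m pi e in auto)
    have "(LINT t|lborel. H t * H t) = (LINT t|lborel. (\<phi> (exp (-t)) * H t - p (exp (-t)) * H t) + p (exp (-t)) * H t)"
      by (simp add: Hsq)
    also have "\<dots> = (LINT t|lborel. \<phi> (exp (-t)) * H t - p (exp (-t)) * H t)"
      using di pi p0 by (subst Bochner_Integration.integral_add) auto
    finally have "norm (LINT t|lborel. H t * H t) \<le> (LINT t|lborel. e * norm (H t))"
      using Bochner_Integration.integral_norm_bound_integral[OF di _ d] Hi by simp
    then show ?thesis by simp
  qed
  have H2i: "integrable lborel (\<lambda>t. H t * H t)"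
  proof (rule Bochner_Integration.integrable_bound[where f="\<lambda>t. C * H t"])
    show "AE t in lborel. norm (H t * H t) \<le> norm (C * H t)"
    proof (rule AE_I2)
      fix t
      have "\<bar>H t\<bar> \<le> C" using B[of t] C0 mult_left_le[of "exp (-t)" C]
        by (cases "0 \<le> t") (auto simp: H_def)
      then show "norm (H t * H t) \<le> norm (C * H t)" using C0 mult_right_mono[of "\<bar>H t\<bar>" C "\<bar>H t\<bar>"]
        by (simp only: real_norm_def abs_mult) simp
    qed
  qed (use Hi in auto)
  have "norm (LINT t|lborel. H t * H t) \<le> 0"
  proof (rule field_le_epsilon)
    fix e :: real assume e: "e > 0"
    define N where "N = (LINT t|lborel. norm (H t))"
    have N: "N \<ge> 0" by (simp add: N_def)
    have "norm (LINT t|lborel. H t * H t) \<le> e / (N + 1) * N"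
      using bound[of "e / (N+1)"] divide_pos_pos[of e "N+1"] e N unfolding N_def by linarith
    also have "\<dots> \<le> e" using e N by (simp add: field_simps)
    finally show "norm (LINT t|lborel. H t * H t) \<le> 0 + e" by simp
  qed
  then have "(LINT t|lborel. H t * H t) = 0" by (simp only: norm_le_zero_iff)
  then have I: "((\<lambda>t. H t * H t) has_integral 0) UNIV"
    using has_integral_integral_lborel[OF H2i] by simp
  \<comment> \<open>From here on \<open>h\<close> replaces \<open>H\<close>, which may jump at 0.
    The upper end \<open>t + 1\<close> keeps the interval nondegenerate when
    \<open>t = 0\<close>.\<close>
  have cc: "continuous_on {0..t+1} (\<lambda>t. h t * h t)"
    using continuous_on_subset[OF h] by (auto intro!: continuous_intros)
  obtain J where J: "((\<lambda>t. h t * h t) has_integral J) {0..t+1}"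
    using integrable_continuous_real[OF cc] by blast
  then have J': "((\<lambda>s. H s * H s) has_integral J) {0..t+1}"
    by (rule has_integral_eq[rotated]) (auto simp: H_def)
  have "J \<le> 0" by (rule has_integral_subset_le[OF _ J' I]) auto
  moreover have "J \<ge> 0" using J by (rule has_integral_nonneg) auto
  ultimately have "((\<lambda>t. h t * h t) has_integral 0) (cbox 0 (t+1))" using J by simp
  then have "h t * h t = 0"
    by (rule has_integral_0_cbox_imp_0[rotated 2]) (use cc t in auto)
  then show ?thesis by simp
qed

text \<open>Lerch's theorem: the moments of \<open>exp (- (M + 1) * t) * f t\<close> against powers
  of \<open>exp (- t)\<close> are the values of the transform at the points
  \<open>M + 1 + n\<close>. The shift by \<open>M + 1\<close> rather than \<open>M\<close> supplies
  the decay \<open>exp (- t)\<close> demanded by the moment lemma.\<close>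

lemma laplace_unique:
  assumes f: "continuous_on {0..} f" and B: "\<And>t. 0 \<le> t \<Longrightarrow> norm (f t) \<le> C * exp (M * t)"
    and z: "\<And>z. M < z \<Longrightarrow> laplace f (of_real z) = 0" and t: "0 \<le> t"
  shows "f t = 0"
proof -
  define g where "g t = exp (of_real (- (M + 1) * t)) * f t" for t
  have gc: "continuous_on {0..} g" unfolding g_def by (intro continuous_intros f)
  have gB: "norm (g t) \<le> C * exp (- t)" if "0 \<le> t" for t
  proof -
    have "norm (g t) \<le> exp (- (M + 1) * t) * (C * exp (M * t))"
      unfolding g_def norm_mult using B[OF that] by (intro mult_mono) auto
    then show ?thesis by (simp add: mult.left_commute exp_add[symmetric] algebra_simps)
  qed
  have L: "(LINT t|lborel. causal (\<lambda>t. of_real (exp (-t) ^ n) * g t) t) = 0"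
      "integrable lborel (causal (\<lambda>t. of_real (exp (-t) ^ n) * g t))" for n
  proof -
    have E: "of_real (exp (-t) ^ n) * g t = exp (- of_real (M + 1 + n) * of_real t) * f t" for t
    proof -
      have "complex_of_real (exp (-t) ^ n) = exp (of_nat n * - of_real t)"
        by (simp only: exp_of_nat_mult of_real_power exp_of_real[symmetric] of_real_minus)
      then have "of_real (exp (-t) ^ n) * g t = exp (of_nat n * - of_real t + of_real (- (M + 1) * t)) * f t"
        by (simp only: g_def exp_add mult.assoc)
      also have "of_nat n * - of_real t + of_real (- (M + 1) * t) = - complex_of_real (M + 1 + n) * of_real t"
        by (simp add: algebra_simps)
      finally show ?thesis .
    qed
    show "(LINT t|lborel. causal (\<lambda>t. of_real (exp (-t) ^ n) * g t) t) = 0"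
      unfolding E laplace_def[symmetric] by (rule z) simp
    show "integrable lborel (causal (\<lambda>t. of_real (exp (-t) ^ n) * g t))"
      unfolding E by (rule laplace_integrable[OF f B]) auto
  qed
  have "Re (g t) = 0"
  proof (rule moments_zero_imp_zero[OF _ _ _ t])
    show "continuous_on {0..} (\<lambda>t. Re (g t))" by (intro continuous_intros gc)
    show "\<bar>Re (g t)\<bar> \<le> C * exp (- t)" if "0 \<le> t" for t
      using gB[OF that] abs_Re_le_cmod[of "g t"] by linarith
    show "(LINT t|lborel. indicator {0..} t * (exp (- t) ^ n * Re (g t))) = 0" for n
    proof -
      have "(LINT t|lborel. indicator {0..} t * (exp (- t) ^ n * Re (g t))) = (LINT t|lborel. Re (causal (\<lambda>t. of_real (exp (-t) ^ n) * g t) t))"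
        by (rule Bochner_Integration.integral_cong) (auto simp: causal_def indicator_def simp del: of_real_power)
      also have "\<dots> = Re (LINT t|lborel. causal (\<lambda>t. of_real (exp (-t) ^ n) * g t) t)" by (rule integral_Re[OF L(2)])
      finally show ?thesis by (simp only: L zero_complex.sel)
    qed
  qed
  moreover have "Im (g t) = 0"
  proof (rule moments_zero_imp_zero[OF _ _ _ t])
    show "continuous_on {0..} (\<lambda>t. Im (g t))" by (intro continuous_intros gc)
    show "\<bar>Im (g t)\<bar> \<le> C * exp (- t)" if "0 \<le> t" for t
      using gB[OF that] abs_Im_le_cmod[of "g t"] by linarith
    show "(LINT t|lborel. indicator {0..} t * (exp (- t) ^ n * Im (g t))) = 0" for n
    proof -
      have "(LINT t|lborel. indicator {0..} t * (exp (- t) ^ n * Im (g t))) = (LINT t|lborel. Im (causal (\<lambda>t. of_real (exp (-t) ^ n) * g t) t))"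
        by (rule Bochner_Integration.integral_cong) (auto simp: causal_def indicator_def simp del: of_real_power)
      also have "\<dots> = Im (LINT t|lborel. causal (\<lambda>t. of_real (exp (-t) ^ n) * g t) t)" by (rule integral_Im[OF L(2)])
      finally show ?thesis by (simp only: L zero_complex.sel)
    qed
  qed
  ultimately have "g t = 0" by (simp add: complex_eq_iff)
  then show ?thesis by (simp add: g_def)
qed

lemma laplace_holomorphic:
  assumes f: "continuous_on {0..} f" and B: "\<And>t. 0 \<le> t \<Longrightarrow> norm (f t) \<le> C"
  shows "laplace f holomorphic_on {s. 0 < Re s}"
proof (rule holomorphic_onI)
  fix s assume "s \<in> {s. 0 < Re s}"
  then have s: "0 < Re s" by simp
  define \<delta> where "\<delta> = Re s / 2"
  have \<delta>: "\<delta> > 0" using s by (simp add: \<delta>_def)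
  have C: "C \<ge> 0" using B[of 0] norm_ge_zero[of "f 0"] by linarith
  have ReB: "Re y > \<delta>" if "y \<in> ball s \<delta>" for y
  proof -
    have "Re s - Re y \<le> norm (s - y)" using complex_Re_le_cmod[of "s - y"] by simp
    then show ?thesis using that s by (simp add: dist_norm \<delta>_def)
  qed
  have int: "integrable lborel (causal (\<lambda>t. exp (- y * of_real t) * f t))" if "0 < Re y" for y
    by (rule laplace_integrable[OF f, of C 0]) (use B that in auto)
  define D where "D = (LINT t|lborel. causal (\<lambda>t. - of_real t * exp (- s * of_real t) * f t) t)"
  have "((\<lambda>y. (laplace f y - laplace f s) / (y - s)) \<longlongrightarrow> D) (at s within ball s \<delta>)"
    unfolding tendsto_at_iff_sequentially
  proof (intro allI impI)
    fix X assume X: "\<forall>i. X i \<in> ball s \<delta> - {s}" "X \<longlonglongrightarrow> s"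
    have Xs: "X i \<noteq> s" "Re (X i) > 0" "X i \<in> ball s \<delta>" for i
      using X(1) ReB[of "X i"] \<delta> by (auto simp: less_trans)
    define q where "q i t = causal (\<lambda>t. (exp (- X i * of_real t) - exp (- s * of_real t)) / (X i - s) * f t) t" for i t
    have q: "(laplace f (X i) - laplace f s) / (X i - s) = (LINT t|lborel. q i t)" for i
    proof -
      have "laplace f (X i) - laplace f s = (LINT t|lborel. causal (\<lambda>t. exp (- X i * of_real t) * f t) t - causal (\<lambda>t. exp (- s * of_real t) * f t) t)"
        unfolding laplace_def using int[OF Xs(2)] int[OF s] by simp
      then have "(laplace f (X i) - laplace f s) / (X i - s) = (LINT t|lborel. (causal (\<lambda>t. exp (- X i * of_real t) * f t) t - causal (\<lambda>t. exp (- s * of_real t) * f t) t) / (X i - s))"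
        by simp
      also have "\<dots> = (LINT t|lborel. q i t)"
        by (rule Bochner_Integration.integral_cong) (auto simp: q_def causal_def algebra_simps diff_divide_distrib)
      finally show ?thesis .
    qed
    have "(\<lambda>i. LINT t|lborel. q i t) \<longlonglongrightarrow> D"
      unfolding D_def
    \<comment> \<open>On the ball \<open>Re y > \<delta>\<close>, so the mean value inequality
      bounds the difference quotient of the exponential by \<open>t * exp (- \<delta> * t)\<close>.
      Since \<open>Gamma 2 = 1\<close>, this is the norm of \<open>frac_kernel 2 \<delta>\<close>,
      whose integrability is already known.\<close>
    proof (rule integral_dominated_convergence[where w="\<lambda>t. norm (frac_kernel 2 \<delta> t) * C"])
      show "integrable lborel (\<lambda>t. norm (frac_kernel 2 \<delta> t) * C)"
        using frac_kernel_integrable[of 2 \<delta>] \<delta> by simp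
      have "continuous_on {0..} (\<lambda>t. - of_real t * exp (- s * of_real t) * f t)" by (intro continuous_intros f)
      then show "causal (\<lambda>t. - of_real t * exp (- s * of_real t) * f t) \<in> borel_measurable lborel"
        using causal_measurable by simp
      have "continuous_on {0..} (\<lambda>t. (exp (- X i * of_real t) - exp (- s * of_real t)) / (X i - s) * f t)" for i
        by (intro continuous_intros f) (use Xs in auto)
      then show "q i \<in> borel_measurable lborel" for i
        using causal_measurable by (simp add: q_def[abs_def])
      have "(\<lambda>i. q i t) \<longlonglongrightarrow> causal (\<lambda>t. - of_real t * exp (- s * of_real t) * f t) t" for t
      proof (cases "0 \<le> t")
        case True
        have "((\<lambda>y. exp (- y * of_real t)) has_field_derivative (- of_real t * exp (- s * of_real t))) (at s)"
          by (auto intro!: derivative_eq_intros)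
        then have "((\<lambda>y. (exp (- y * of_real t) - exp (- s * of_real t)) / (y - s)) \<longlongrightarrow> - of_real t * exp (- s * of_real t)) (at s)"
          by (simp add: has_field_derivative_iff)
        then have "((\<lambda>y. (exp (- y * of_real t) - exp (- s * of_real t)) / (y - s)) \<circ> X) \<longlonglongrightarrow> - of_real t * exp (- s * of_real t)"
          using X unfolding tendsto_at_iff_sequentially by blast
        then have "(\<lambda>i. (exp (- X i * of_real t) - exp (- s * of_real t)) / (X i - s) * f t) \<longlonglongrightarrow> - of_real t * exp (- s * of_real t) * f t"
          by (intro tendsto_intros) (simp add: o_def)
        then show ?thesis using True by (simp add: q_def causal_def)
      qed (simp add: q_def causal_def)
      then show "AE t in lborel. (\<lambda>i. q i t) \<longlonglongrightarrow> causal (\<lambda>t. - of_real t * exp (- s * of_real t) * f t) t" by simp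
      have "norm (q i t) \<le> norm (frac_kernel 2 \<delta> t) * C" for i t
      proof (cases "0 \<le> t")
        case True
        have "norm (exp (- X i * of_real t) - exp (- s * of_real t)) \<le> (t * exp (- \<delta> * t)) * norm (X i - s)"
        proof (rule field_differentiable_bound[where S="ball s \<delta>" and f'="\<lambda>y. - of_real t * exp (- y * of_real t)"])
          fix y assume y: "y \<in> ball s \<delta>"
          show "((\<lambda>y. exp (- y * of_real t)) has_field_derivative (- of_real t * exp (- y * of_real t))) (at y within ball s \<delta>)"
            by (auto intro!: derivative_eq_intros)
          show "norm (- of_real t * exp (- y * of_real t)) \<le> t * exp (- \<delta> * t)"
            using ReB[OF y] True by (auto simp: norm_mult intro!: mult_left_mono mult_right_mono)
        qed (use Xs \<delta> in auto)
        then have "norm ((exp (- X i * of_real t) - exp (- s * of_real t)) / (X i - s)) \<le> t * exp (- \<delta> * t)"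
          using Xs by (simp add: norm_divide divide_le_eq)
        then have "norm (q i t) \<le> (t * exp (- \<delta> * t)) * C"
          using True B[OF True] C unfolding q_def causal_def if_P[OF True] norm_mult
          by (intro mult_mono) auto
        also have "t * exp (- \<delta> * t) = norm (frac_kernel 2 \<delta> t)"
          using True by (auto simp: frac_kernel_def causal_def norm_mult powr_one Gamma_numeral)
        finally show ?thesis .
      qed (simp add: q_def causal_def C)
      then show "AE t in lborel. norm (q i t) \<le> norm (frac_kernel 2 \<delta> t) * C" for i by simp
    qed
    then show "((\<lambda>y. (laplace f y - laplace f s) / (y - s)) \<circ> X) \<longlonglongrightarrow> D"
      by (simp add: o_def q)
  qed
  then have "(laplace f has_field_derivative D) (at s within ball s \<delta>)"
    by (simp add: has_field_derivative_iff)
  then have "(laplace f has_field_derivative D) (at s)"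
    using \<delta> by (simp add: at_within_open[of s "ball s \<delta>"])
  then show "laplace f field_differentiable (at s within {s. 0 < Re s})"
    using field_differentiable_def field_differentiable_at_within by blast
qed

section \<open>Existence and exponential growth of solutions\<close>

lemma conv_causal_cong:
  assumes "\<And>s. 0 \<le> s \<Longrightarrow> s \<le> t \<Longrightarrow> F s = G s"
  shows "conv (causal K) (causal F) t = conv (causal K) (causal G) t"
  unfolding conv_def by (rule Bochner_Integration.integral_cong) (auto simp: causal_def assms)

lemma frac_kernel_conv_cong:
  assumes "\<And>s. 0 \<le> s \<Longrightarrow> s \<le> t \<Longrightarrow> F s = G s"
  shows "conv (frac_kernel \<beta> M) (causal F) t = conv (frac_kernel \<beta> M) (causal G) t"
  unfolding frac_kernel_def by (rule conv_causal_cong[OF assms])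

lemma norm_vec_le_sum:
  fixes v :: "complex ^ 'd::finite"
  shows "norm v \<le> (\<Sum>i\<in>UNIV. norm (v $ i))"
  unfolding norm_vec_def by (rule L2_set_le_sum) simp

lemma powr_neg_tendsto_0: "0 < \<beta> \<Longrightarrow> ((\<lambda>M. M powr - \<beta>) \<longlongrightarrow> (0::real)) at_top"
  by (rule tendsto_neg_powr) (auto simp: filterlim_ident)

text \<open>The damped unknown \<open>exp (- M * t) * x t\<close> solves a fixed-point equation on
  bounded continuous functions. Its Lipschitz constant is controlled by the kernel masses times the
  row sums of \<open>a\<close>, so for large \<open>M\<close> a single contraction yields a solution
  on the whole half-line at once.\<close>

lemma caputo_solution_exists:
  fixes \<alpha> :: "'d::{finite,linorder} \<Rightarrow> real"
  assumes \<alpha>: "\<And>i. 0 < \<alpha> i"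
  shows "\<exists>x. is_caputo_solution \<alpha> a x0 x"
proof -
  define S where "S i = (\<Sum>j\<in>{i..}. norm (a i j))" for i
  have S0: "S i \<ge> 0" for i unfolding S_def by (intro sum_nonneg) simp
  \<comment> \<open>All components are summed because the norm of a vector will be estimated by the
    sum of the norms of its entries.\<close>
  have "((\<lambda>M. \<Sum>i\<in>UNIV. M powr - \<alpha> i * S i) \<longlongrightarrow> (\<Sum>i\<in>(UNIV::'d set). 0 * S i)) at_top"
    by (intro tendsto_intros powr_neg_tendsto_0 \<alpha>)
  then have "eventually (\<lambda>M. (\<Sum>i\<in>UNIV. M powr - \<alpha> i * S i) < 1/2) at_top"
    by (rule order_tendstoD) simp
  then have "eventually (\<lambda>M. (\<Sum>i\<in>UNIV. M powr - \<alpha> i * S i) < 1/2 \<and> M > 0) at_top"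
    using eventually_gt_at_top[of "0::real"] by eventually_elim simp
  then obtain M :: real where M: "(\<Sum>i\<in>UNIV. M powr - \<alpha> i * S i) < 1/2" "M > 0"
    using eventually_happens by fastforce
  define F where "F y i s = (\<Sum>j\<in>{i..}. a i j * y s $ j)" for y :: "real \<Rightarrow> complex ^ 'd::{finite,linorder}" and i s
  \<comment> \<open>The functions live on the whole real line. For negative \<open>t\<close> the
    convolution vanishes, and \<open>max 0 t\<close> keeps the initial term bounded there.\<close>
  define T where "T y t = (\<chi> i. of_real (exp (- M * max 0 t)) * x0 $ i + conv (frac_kernel (\<alpha> i) M) (causal (F y i)) t)" for y t
  have Fb: "norm (F y i s) \<le> S i * B" if "\<And>s. norm (y s) \<le> B" for y B i s
  proof -
    have "norm (F y i s) \<le> (\<Sum>j\<in>{i..}. norm (a i j) * B)"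
      unfolding F_def norm_mult[symmetric]
      by (rule sum_norm_le) (use that order_trans[OF Finite_Cartesian_Product.norm_nth_le] in \<open>auto simp: norm_mult intro!: mult_left_mono\<close>)
    then show ?thesis by (simp add: S_def sum_distrib_right)
  qed
  have Fc: "continuous_on A (F y i)" if "continuous_on A y" for y i and A :: "real set"
    unfolding F_def using that by (intro continuous_intros)
  have diffT: "norm (T y t - T z t) \<le> 1/2 * B"
    if y: "continuous_on UNIV y" "bounded (range y)" and z: "continuous_on UNIV z" "bounded (range z)"
      and B: "\<And>s. norm (y s - z s) \<le> B" for y z B t
  proof -
    have B0: "B \<ge> 0" using B[of 0] order_trans[OF norm_ge_zero] by blast
    obtain By where By: "\<And>s. norm (y s) \<le> By" using y(2) by (auto simp: bounded_iff)
    obtain Bz where Bz: "\<And>s. norm (z s) \<le> Bz" using z(2) by (auto simp: bounded_iff)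
    have By0: "By \<ge> 0" using By[of 0] order_trans[OF norm_ge_zero] by blast
    have Bz0: "Bz \<ge> 0" using Bz[of 0] order_trans[OF norm_ge_zero] by blast
    have c: "norm ((T y t - T z t) $ i) \<le> M powr - \<alpha> i * S i * B" for i
    proof -
      have yi: "integrable lborel (\<lambda>s. frac_kernel (\<alpha> i) M (t - s) * causal (F y i) s)"
        by (rule conv_integrand_integrable'[OF frac_kernel_integrable[OF \<alpha> M(2)]
             causal_measurable[OF Fc[OF continuous_on_subset[OF y(1)]]] causal_bound[OF Fb[OF By]]])
           (use S0 By0 in auto)
      have zi: "integrable lborel (\<lambda>s. frac_kernel (\<alpha> i) M (t - s) * causal (F z i) s)"
        by (rule conv_integrand_integrable'[OF frac_kernel_integrable[OF \<alpha> M(2)]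
             causal_measurable[OF Fc[OF continuous_on_subset[OF z(1)]]] causal_bound[OF Fb[OF Bz]]])
           (use S0 Bz0 in auto)
      have "(T y t - T z t) $ i = conv (frac_kernel (\<alpha> i) M) (causal (F y i)) t - conv (frac_kernel (\<alpha> i) M) (causal (F z i)) t"
        by (simp add: T_def)
      also have "\<dots> = conv (frac_kernel (\<alpha> i) M) (causal (F (\<lambda>s. y s - z s) i)) t"
        unfolding conv_def Bochner_Integration.integral_diff[OF yi zi, symmetric]
        by (rule Bochner_Integration.integral_cong)
           (auto simp: causal_def F_def sum_subtractf right_diff_distrib)
      also have "norm \<dots> \<le> (LINT u|lborel. norm (frac_kernel (\<alpha> i) M u)) * (S i * B)"
        by (rule conv_bound[OF frac_kernel_integrable[OF \<alpha> M(2)] causal_measurable[OF Fc] causal_bound[OF Fb[OF B]]])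
           (use S0 B0 continuous_on_subset[OF y(1)] continuous_on_subset[OF z(1)] in \<open>auto intro!: continuous_intros\<close>)
      finally show ?thesis using frac_kernel_norm_integral[OF \<alpha> M(2)] by simp
    qed
    have "norm (T y t - T z t) \<le> (\<Sum>i\<in>UNIV. M powr - \<alpha> i * S i * B)"
      by (rule order_trans[OF norm_vec_le_sum sum_mono]) (rule c)
    also have "\<dots> = (\<Sum>i\<in>UNIV. M powr - \<alpha> i * S i) * B" by (simp add: sum_distrib_right)
    also have "\<dots> \<le> 1/2 * B" using M B0 by (intro mult_right_mono) auto
    finally show ?thesis .
  qed
  have TC: "T y \<in> bcontfun" if y: "continuous_on UNIV y" "bounded (range y)" for y
  proof -
    obtain By where By: "\<And>s. norm (y s) \<le> By" using y(2) by (auto simp: bounded_iff)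
    have By0: "By \<ge> 0" using By[of 0] order_trans[OF norm_ge_zero] by blast
    have cb: "norm (causal (F y i) t) \<le> S i * By" for i t
      by (rule causal_bound[OF Fb[OF By]]) (use S0 By0 in auto)
    have cm: "causal (F y i) \<in> borel_measurable borel" for i
      by (rule causal_measurable[OF Fc[OF continuous_on_subset[OF y(1)]]]) auto
    have ci: "isCont (causal (F y i)) t" if "t \<noteq> 0" for i t
      by (rule causal_isCont[OF Fc[OF continuous_on_subset[OF y(1)]] that]) auto
    have cc: "continuous_on UNIV (conv (frac_kernel (\<alpha> i) M) (causal (F y i)))" for i
      using conv_continuous[OF frac_kernel_integrable[OF \<alpha> M(2)] cm cb ci] by (auto intro: continuous_at_imp_continuous_on)
    have "continuous_on UNIV (T y)"
      unfolding T_def by (intro continuous_intros cc)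
    moreover have "norm (T y t) \<le> (\<Sum>i\<in>UNIV. norm (x0 $ i) + M powr - \<alpha> i * (S i * By))" for t
    proof (rule order_trans[OF norm_vec_le_sum sum_mono])
      fix i
      have "norm (T y t $ i) \<le> norm (of_real (exp (- M * max 0 t)) * x0 $ i) + norm (conv (frac_kernel (\<alpha> i) M) (causal (F y i)) t)"
        unfolding T_def by (simp add: norm_triangle_ineq)
      also have "norm (of_real (exp (- M * max 0 t)) * x0 $ i) \<le> norm (x0 $ i)"
        using M(2) by (auto simp: norm_mult intro!: mult_left_le_one_le)
      also have "norm (conv (frac_kernel (\<alpha> i) M) (causal (F y i)) t) \<le> M powr - \<alpha> i * (S i * By)"
        using conv_bound[OF frac_kernel_integrable[OF \<alpha> M(2)] cm cb] frac_kernel_norm_integral[OF \<alpha> M(2)] by metis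
      finally show "norm (T y t $ i) \<le> norm (x0 $ i) + M powr - \<alpha> i * (S i * By)" by simp
    qed
    then have "bounded (range (T y))" by (auto simp: bounded_iff)
    ultimately show ?thesis by (simp add: bcontfun_def)
  qed
  define TT where "TT y = Bcontfun (T (apply_bcontfun y))" for y
  have TT: "apply_bcontfun (TT y) = T (apply_bcontfun y)" for y
    unfolding TT_def by (intro Bcontfun_inverse TC) auto
  have "\<exists>!y. TT y = y"
  proof (rule banach_fix_type[of "1/2"])
    show "\<forall>y z. dist (TT y) (TT z) \<le> 1/2 * dist y z"
    proof (intro allI dist_bound)
      fix y z t
      show "dist (apply_bcontfun (TT y) t) (apply_bcontfun (TT z) t) \<le> 1/2 * dist y z"
        unfolding TT dist_norm[of "T _ _"]
        by (rule diffT) (use dist_bounded[of y _ z] in \<open>auto simp: dist_norm\<close>)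
    qed
  qed auto
  then obtain yb where "TT yb = yb" by auto
  then have yb: "T (apply_bcontfun yb) = apply_bcontfun yb" using TT by metis
  define y where "y = apply_bcontfun yb"
  have yT: "y t = T y t" for t using yb by (simp add: y_def)
  define x where "x t = exp (M * t) *\<^sub>R y t" for t
  have "is_caputo_solution \<alpha> a x0 x"
    unfolding is_caputo_solution_def
  proof (intro conjI allI impI)
    show "continuous_on {0..} x" unfolding x_def y_def by (intro continuous_intros) auto
    fix t :: real and i assume t: "0 \<le> t"
    have xj: "x s $ j = of_real (exp (M * s)) * y s $ j" for s j
      unfolding x_def vector_scaleR_component scaleR_conv_of_real[of _ "y s $ j"] by (rule refl)
    have E: "complex_of_real (exp (- M * s)) * of_real (exp (M * s)) = 1" for s
      unfolding of_real_mult[symmetric] exp_add[symmetric] by simp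
    have "(\<lambda>s. of_real (exp (- M * s)) * (\<Sum>j\<in>{i..}. a i j * x s $ j)) = F y i"
      unfolding F_def xj sum_distrib_left
      by (intro ext sum.cong refl) (metis E mult.left_commute mult.right_neutral)
    then have "conv (frac_kernel (\<alpha> i) M) (causal (F y i)) t =
       of_real (exp (- M * t)) * frac_integral (\<alpha> i) (\<lambda>s. \<Sum>j\<in>{i..}. a i j * x s $ j) t"
      using frac_integral_conv[of M t "\<alpha> i" "\<lambda>s. \<Sum>j\<in>{i..}. a i j * x s $ j"] by simp
    then have "y t $ i = of_real (exp (- M * t)) * (x0 $ i + frac_integral (\<alpha> i) (\<lambda>s. \<Sum>j\<in>{i..}. a i j * x s $ j) t)"
      using t by (subst yT) (simp add: T_def algebra_simps)
    then have "x t $ i = (of_real (exp (- M * t)) * of_real (exp (M * t))) * (x0 $ i + frac_integral (\<alpha> i) (\<lambda>s. \<Sum>j\<in>{i..}. a i j * x s $ j) t)"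
      unfolding xj by (simp only: mult_ac)
    then show "x t $ i = x0 $ i + frac_integral (\<alpha> i) (\<lambda>s. \<Sum>j\<in>{i..}. a i j * x s $ j) t"
      by (simp only: E mult_1)
  qed
  then show ?thesis by blast
qed

text \<open>On \<open>{0..t}\<close> the damped solution attains a maximum at some
  \<open>t0\<close>. The equation at \<open>t0\<close> bounds this maximum by half of itself plus
  \<open>norm x0 + G\<close>, and absorbing the half leaves a bound that does not depend on
  \<open>t\<close>.\<close>

lemma scalar_solution_growth:
  assumes b: "0 < \<beta>" and x: "continuous_on {0..} x" and g: "continuous_on {0..} g"
    and G: "\<And>t. 0 \<le> t \<Longrightarrow> norm (g t) \<le> G"
    and eq: "\<And>t. 0 \<le> t \<Longrightarrow> x t = x0 + frac_integral \<beta> (\<lambda>s. l * x s + g s) t"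
  obtains C M where "0 < M" "\<And>t. 0 \<le> t \<Longrightarrow> norm (x t) \<le> C * exp (M * t)"
proof -
  have "((\<lambda>M. M powr - \<beta> * norm l) \<longlongrightarrow> 0 * norm l) at_top"
    by (intro tendsto_intros powr_neg_tendsto_0 b)
  then have "eventually (\<lambda>M. M powr - \<beta> * norm l < 1/2) at_top"
    by (rule order_tendstoD) simp
  \<comment> \<open>With \<open>M \<ge> 1\<close> the kernel has mass at most 1, so the forcing
    contributes at most \<open>G\<close>.\<close>
  then have "eventually (\<lambda>M. M powr - \<beta> * norm l < 1/2 \<and> M \<ge> 1) at_top"
    using eventually_ge_at_top[of "1::real"] by eventually_elim simp
  then obtain M :: real where M: "M powr - \<beta> * norm l < 1/2" "M \<ge> 1"
    using eventually_happens by fastforce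
  have M0: "M > 0" using M by simp
  have Mb: "M powr - \<beta> \<le> 1" using M b by (simp add: powr_minus ge_one_powr_ge_zero inverse_le_1_iff)
  have G0: "G \<ge> 0" using G[of 0] order_trans[OF norm_ge_zero] by simp
  have "norm (x t) \<le> 2 * (norm x0 + G) * exp (M * t)" if t: "0 \<le> t" for t
  proof -
    define y where "y s = norm (of_real (exp (- M * s)) * x s)" for s
    have yc: "continuous_on {0..t} y" unfolding y_def
      by (intro continuous_intros continuous_on_subset[OF x]) auto
    obtain t0 where t0: "t0 \<in> {0..t}" "\<And>s. s \<in> {0..t} \<Longrightarrow> y s \<le> y t0"
      using continuous_attains_sup[OF _ _ yc] t by auto
    define F where "F s = of_real (exp (- M * s)) * (l * x s + g s)" for s
    have Fc: "continuous_on {0..} F" unfolding F_def by (intro continuous_intros x g)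
    \<comment> \<open>\<open>conv_bound\<close> asks for a bound on the whole half-line, but
      \<open>F\<close> is controlled only on \<open>{0..t}\<close>. Freezing it after
      \<open>t\<close> leaves the convolution at \<open>t0 \<le> t\<close> unchanged.\<close>
    define F1 where "F1 s = F (min s t)" for s
    have F1c: "continuous_on {0..} F1" unfolding F1_def
      by (rule continuous_on_compose2[OF Fc]) (use t in \<open>auto intro!: continuous_intros\<close>)
    have Fb: "norm (F s) \<le> norm l * y t0 + G" if "s \<in> {0..t}" for s
    proof -
      have "norm (F s) \<le> norm (l * (of_real (exp (- M * s)) * x s)) + norm (of_real (exp (- M * s)) * g s)"
        unfolding F_def distrib_left by (rule order_trans[OF norm_triangle_ineq]) (simp add: mult_ac)
      also have "norm (l * (of_real (exp (- M * s)) * x s)) \<le> norm l * y t0"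
        using t0(2)[OF that] by (simp add: norm_mult y_def mult_left_mono)
      also have "norm (of_real (exp (- M * s)) * g s) \<le> 1 * G"
        unfolding norm_mult using that M0 G by (intro mult_mono) auto
      finally show ?thesis by simp
    qed
    have F1b: "norm (F1 s) \<le> norm l * y t0 + G" if "0 \<le> s" for s
      unfolding F1_def by (rule Fb) (use t that in auto)
    have t0p: "0 \<le> t0" "t0 \<le> t" using t0 by auto
    have y0: "y t0 \<ge> 0" by (simp add: y_def)
    have "of_real (exp (- M * t0)) * x t0 = of_real (exp (- M * t0)) * x0 + conv (frac_kernel \<beta> M) (causal F) t0"
      unfolding eq[OF t0p(1)] distrib_left frac_integral_conv F_def by simp
    also have "conv (frac_kernel \<beta> M) (causal F) t0 = conv (frac_kernel \<beta> M) (causal F1) t0"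
      by (rule frac_kernel_conv_cong) (use t0p in \<open>simp add: F1_def min_def\<close>)
    finally have "y t0 \<le> norm (of_real (exp (- M * t0)) * x0) + norm (conv (frac_kernel \<beta> M) (causal F1) t0)"
      unfolding y_def by (simp only: norm_triangle_ineq)
    also have "norm (of_real (exp (- M * t0)) * x0) \<le> norm x0"
      using M0 t0p by (auto simp: norm_mult intro!: mult_left_le_one_le)
    also have "norm (conv (frac_kernel \<beta> M) (causal F1) t0) \<le> M powr - \<beta> * (norm l * y t0 + G)"
      using conv_bound[OF frac_kernel_integrable[OF b M0] causal_measurable[OF F1c] causal_bound[OF F1b], of t0]
        frac_kernel_norm_integral[OF b M0] y0 G0 by simp
    also have "M powr - \<beta> * (norm l * y t0 + G) \<le> 1/2 * y t0 + 1 * G"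
      unfolding distrib_left mult.assoc[symmetric] using M Mb y0 G0 by (intro add_mono mult_right_mono) auto
    finally have "y t0 \<le> 2 * (norm x0 + G)" by simp
    then have "y t \<le> 2 * (norm x0 + G)" using t0(2)[of t] t by simp
    then have "exp (M * t) * y t \<le> exp (M * t) * (2 * (norm x0 + G))" by simp
    moreover have "exp (M * t) * y t = norm (x t)"
      by (simp add: y_def norm_mult mult.assoc[symmetric] exp_add[symmetric])
    ultimately show ?thesis by (simp only: mult.commute)
  qed
  then show ?thesis using that M0 by blast
qed

section \<open>The integrable resolvent\<close>

text \<open>Law of cosines for the points \<open>exp w\<close> and \<open>l\<close>, seen from 0
  under an angle of at least \<open>\<delta> = \<bar>Arg l\<bar> - \<psi>\<close>. With moduli
  \<open>X\<close> and \<open>L\<close>, the quantity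
  \<open>X\<^sup>2 + L\<^sup>2 - 2 * X * L * cos \<delta>\<close> is the combination of
  \<open>(X + L)\<^sup>2\<close> and \<open>(X - L)\<^sup>2\<close> with weights
  \<open>(1 - cos \<delta>) / 2\<close> and \<open>(1 + cos \<delta>) / 2\<close>; the constant is
  the root of the first weight.\<close>

lemma sector_distance:
  fixes l w :: complex
  assumes \<psi>: "\<bar>Im w\<bar> \<le> \<psi>" "\<psi> < \<bar>Arg l\<bar>"
  shows "norm (exp w - l) \<ge> sqrt ((1 - cos (\<bar>Arg l\<bar> - \<psi>)) / 2) * (exp (Re w) + norm l)"
proof -
  define A where "A = Arg l"
  define \<delta> where "\<delta> = \<bar>A\<bar> - \<psi>"
  define X where "X = exp (Re w)"
  define L where "L = norm l"
  have A: "\<bar>A\<bar> \<le> pi" using Arg_bounded[of l] by (auto simp: A_def)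
  have \<delta>: "0 < \<delta>" "\<delta> \<le> pi" using \<psi> A by (auto simp: \<delta>_def A_def)
  \<comment> \<open>The difference of the arguments may exceed pi, so its distance from 2 * pi has
    to be controlled as well.\<close>
  have v: "\<delta> \<le> \<bar>Im w - A\<bar>" "\<bar>Im w - A\<bar> \<le> 2 * pi - \<delta>"
    using \<psi>(1) A by (auto simp: \<delta>_def)
  have "cos \<bar>Im w - A\<bar> \<le> cos \<delta>"
  proof (cases "\<bar>Im w - A\<bar> \<le> pi")
    case True
    then show ?thesis using v \<delta> by (intro cos_monotone_0_pi_le) auto
  next
    case False
    have "cos \<bar>Im w - A\<bar> = cos (2 * pi - \<bar>Im w - A\<bar>)" by (metis cos_2pi_minus)
    also have "\<dots> \<le> cos \<delta>" using v \<delta> False by (intro cos_monotone_0_pi_le) auto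
    finally show ?thesis .
  qed
  then have c: "cos (Im w - A) \<le> cos \<delta>" by simp
  have l: "Re l = L * cos A" "Im l = L * sin A"
    using rcis_cmod_Arg[of l] by (metis A_def L_def Re_rcis, metis A_def L_def Im_rcis)
  have XL: "X \<ge> 0" "L \<ge> 0" by (auto simp: X_def L_def)
  have "(norm (exp w - l))\<^sup>2 = (X * cos (Im w) - L * cos A)\<^sup>2 + (X * sin (Im w) - L * sin A)\<^sup>2"
    by (simp add: cmod_power2 l Re_exp Im_exp X_def)
  also have "\<dots> = X\<^sup>2 * ((sin (Im w))\<^sup>2 + (cos (Im w))\<^sup>2) + L\<^sup>2 * ((sin A)\<^sup>2 + (cos A)\<^sup>2) - 2 * X * L * cos (Im w - A)"
    unfolding cos_diff by algebra
  also have "\<dots> = X\<^sup>2 + L\<^sup>2 - 2 * X * L * cos (Im w - A)" by simp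
  also have "\<dots> \<ge> X\<^sup>2 + L\<^sup>2 - 2 * X * L * cos \<delta>"
    using c XL by (simp add: mult_left_mono)
  also have "X\<^sup>2 + L\<^sup>2 - 2 * X * L * cos \<delta> = (1 - cos \<delta>) / 2 * (X + L)\<^sup>2 + (1 + cos \<delta>) / 2 * (X - L)\<^sup>2"
    by (simp add: power2_eq_square field_simps)
  finally have "(norm (exp w - l))\<^sup>2 \<ge> (1 - cos \<delta>) / 2 * (X + L)\<^sup>2 + (1 + cos \<delta>) / 2 * (X - L)\<^sup>2" .
  moreover have "(1 + cos \<delta>) / 2 * (X - L)\<^sup>2 \<ge> 0"
  proof -
    have "1 + cos \<delta> \<ge> 0" using cos_ge_minus_one[of \<delta>] by linarith
    then show ?thesis by simp
  qed
  ultimately have "(norm (exp w - l))\<^sup>2 \<ge> (1 - cos \<delta>) / 2 * (X + L)\<^sup>2" by linarith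
  also have "(1 - cos \<delta>) / 2 * (X + L)\<^sup>2 = (sqrt ((1 - cos \<delta>) / 2) * (X + L))\<^sup>2"
    by (simp add: power_mult_distrib)
  finally show ?thesis
    unfolding \<delta>_def A_def X_def L_def by (rule power2_le_imp_le) simp
qed

lemma sector_distance':
  fixes l :: complex
  assumes \<psi>: "0 \<le> \<psi>" "\<psi> < \<bar>Arg l\<bar>"
  obtains c where "c > 0" "\<And>w. \<bar>Im w\<bar> \<le> \<psi> \<Longrightarrow> norm (exp w - l) \<ge> c * (exp (Re w) + norm l)"
proof
  have "\<bar>Arg l\<bar> \<le> pi" using Arg_bounded[of l] by auto
  then have "cos (\<bar>Arg l\<bar> - \<psi>) < cos 0"
    using \<psi> by (intro cos_monotone_0_pi) auto
  then show "sqrt ((1 - cos (\<bar>Arg l\<bar> - \<psi>)) / 2) > 0" by simp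
qed (rule sector_distance[OF _ \<psi>(2)])

lemma exp_abs_integrable:
  assumes "0 < (\<alpha>::real)"
  shows "integrable lborel (\<lambda>u. exp (- \<alpha> * \<bar>u\<bar>))"
proof -
  define n where "n u = norm (causal (\<lambda>t. exp (of_real (- \<alpha>) * of_real t)) u)" for u :: real
  have i: "integrable lborel n" unfolding n_def
    by (intro integrable_norm causal_exp_integrable) (use assms in auto)
  have i': "integrable lborel (\<lambda>u. n (- u))"
    using lborel_integrable_real_affine[OF i, of "-1" 0] by simp
  show ?thesis
    by (rule Bochner_Integration.integrable_bound[OF Bochner_Integration.integrable_add[OF i i']])
       (auto simp: n_def causal_def)
qed

lemma causal_exp_norm_integral:
  assumes c: "Re c < 0"
  shows "(LINT t|lborel. norm (causal (\<lambda>t. exp (c * of_real t)) t)) = - 1 / Re c"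
proof -
  have "complex_of_real (LINT t|lborel. norm (causal (\<lambda>t. exp (c * of_real t)) t))
     = (LINT t|lborel. complex_of_real (norm (causal (\<lambda>t. exp (c * of_real t)) t)))" by simp
  also have "\<dots> = (LINT t|lborel. causal (\<lambda>t. exp (of_real (Re c) * of_real t)) t)"
    by (rule Bochner_Integration.integral_cong) (auto simp: causal_def exp_of_real[symmetric] simp del: exp_of_real)
  also have "\<dots> = of_real (- 1 / Re c)" using causal_exp_integral[of "of_real (Re c)"] c by simp
  finally show ?thesis using of_real_eq_iff by blast
qed

section \<open>Contour integrals along horizontal lines and the inverse transform over two
  rays\<close>

definition hline :: "real \<Rightarrow> real \<Rightarrow> complex" where
  "hline \<sigma> u = of_real u + \<i> * of_real \<sigma>"

lemma Re_hline [simp]: "Re (hline \<sigma> u) = u" and Im_hline [simp]: "Im (hline \<sigma> u) = \<sigma>"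
  by (simp_all add: hline_def)

text \<open>Multiplication by \<open>\<i>\<close> turns the segment into a vertical one, to which
  \<open>contour_integral_linepath_same_Re\<close> applies.\<close>

lemma contour_integral_horizontal:
  assumes "a < b"
  shows "contour_integral (linepath (hline \<sigma> a) (hline \<sigma> b)) f = integral {a..b} (\<lambda>u. f (hline \<sigma> u))"
proof -
  let ?g = "\<lambda>w. f (- \<i> * w)"
  have "contour_integral (linepath (\<i> * hline \<sigma> a) (\<i> * hline \<sigma> b)) ?g = \<i> * contour_integral (linepath (hline \<sigma> a) (hline \<sigma> b)) f"
  proof -
    have "- \<i> * linepath (\<i> * hline \<sigma> a) (\<i> * hline \<sigma> b) x = linepath (hline \<sigma> a) (hline \<sigma> b) x" for x
      by (simp add: linepath_def scaleR_conv_of_real algebra_simps)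
    then have "contour_integral (linepath (\<i> * hline \<sigma> a) (\<i> * hline \<sigma> b)) ?g
        = integral {0..1} (\<lambda>x. \<i> * (f (linepath (hline \<sigma> a) (hline \<sigma> b) x) * (hline \<sigma> b - hline \<sigma> a)))"
      unfolding contour_integral_integral
      by (intro integral_cong) (simp add: algebra_simps)
    also have "\<dots> = \<i> * contour_integral (linepath (hline \<sigma> a) (hline \<sigma> b)) f"
      unfolding contour_integral_integral integral_mult_right by simp
    finally show ?thesis .
  qed
  moreover have "contour_integral (linepath (\<i> * hline \<sigma> a) (\<i> * hline \<sigma> b)) ?g = \<i> * integral {a..b} (\<lambda>x. ?g (Complex (- \<sigma>) x))"
    by (rule contour_integral_linepath_same_Re) (use assms in auto)
  moreover have "- \<i> * Complex (- \<sigma>) x = hline \<sigma> x" for x by (simp add: complex_eq_iff)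
  ultimately show ?thesis by simp
qed

text \<open>The rays have angle \<theta> > pi / 2, so that \<open>exp (s * t)\<close> decays along
  them. The slightly larger \<theta>1 gives an open strip around the contour:
  \<open>\<alpha> * \<theta>1 < \<bar>Arg l\<bar>\<close> keeps \<open>s powr \<alpha>\<close> away
  from \<open>l\<close> on it, and \<open>\<theta>1 < pi\<close> keeps \<open>s\<close> away from
  -1.\<close>

locale sector =
  fixes l :: complex and \<alpha> \<theta> \<theta>1 :: real
  assumes \<alpha>: "0 < \<alpha>" "\<alpha> \<le> 1" and \<theta>: "pi / 2 < \<theta>" "\<theta> < \<theta>1" "\<theta>1 < pi"
    and l: "\<alpha> * \<theta>1 < \<bar>Arg l\<bar>"
begin

lemma \<theta>_pos: "0 < \<theta>" "0 < \<theta>1"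
  using \<theta> pi_gt_zero by linarith+

lemma cos_\<theta>: "cos \<theta> < 0"
proof -
  have "cos \<theta> < cos (pi / 2)" using \<theta> by (intro cos_monotone_0_pi) auto
  then show ?thesis by simp
qed

lemma l_nonzero: "l \<noteq> 0"
proof
  assume "l = 0"
  then have "\<alpha> * \<theta>1 < 0" using l by (simp add: Arg_zero)
  moreover have "0 < \<alpha> * \<theta>1" using \<alpha> \<theta>_pos by simp
  ultimately show False by simp
qed

text \<open>The substitution \<open>s = exp w\<close> turns the two rays of the contour into the lines \<open>Im w = \<theta>\<close> and \<open>Im w = -\<theta>\<close>.
  The term \<open>1 / (l * (1 + s))\<close> cancels the constant part of \<open>1 / (s powr \<alpha> - l)\<close> at \<open>s = 0\<close>,
  where the latter alone would leave a non-integrable singularity on the contour.\<close>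

definition H :: "complex \<Rightarrow> complex" where
  "H w = 1 / (exp (of_real \<alpha> * w) - l) + 1 / (l * (1 + exp w))"

text \<open>Both are instances of the sector estimate: the second is taken at -1, whose argument is
  pi.\<close>

lemma lower_bounds:
  obtains c where "c > 0"
    "\<And>w. \<bar>Im w\<bar> \<le> \<theta>1 \<Longrightarrow> norm (exp (of_real \<alpha> * w) - l) \<ge> c * (exp (\<alpha> * Re w) + norm l)"
    "\<And>w. \<bar>Im w\<bar> \<le> \<theta>1 \<Longrightarrow> norm (1 + exp w) \<ge> c * (exp (Re w) + 1)"
proof -
  obtain c1 where c1: "c1 > 0" "\<And>w. \<bar>Im w\<bar> \<le> \<alpha> * \<theta>1 \<Longrightarrow> norm (exp w - l) \<ge> c1 * (exp (Re w) + norm l)"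
    using sector_distance'[of "\<alpha> * \<theta>1" l] \<alpha> \<theta>_pos l by auto
  obtain c2 where c2: "c2 > 0" "\<And>w. \<bar>Im w\<bar> \<le> \<theta>1 \<Longrightarrow> norm (exp w - (-1)) \<ge> c2 * (exp (Re w) + norm (-1::complex))"
    using sector_distance'[of \<theta>1 "-1"] Arg_of_real[of "-1"] \<theta> \<theta>_pos by auto
  show ?thesis
  proof (rule that[of "min c1 c2"])
    show "min c1 c2 > 0" using c1 c2 by simp
  next
    fix w :: complex assume w: "\<bar>Im w\<bar> \<le> \<theta>1"
    have "\<bar>Im (of_real \<alpha> * w)\<bar> \<le> \<alpha> * \<theta>1" using w \<alpha> by (simp add: abs_mult)
    from c1(2)[OF this] have "c1 * (exp (\<alpha> * Re w) + norm l) \<le> norm (exp (of_real \<alpha> * w) - l)" by simp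
    moreover have "min c1 c2 * (exp (\<alpha> * Re w) + norm l) \<le> c1 * (exp (\<alpha> * Re w) + norm l)"
      by (intro mult_right_mono) (auto intro: add_nonneg_nonneg)
    ultimately show "norm (exp (of_real \<alpha> * w) - l) \<ge> min c1 c2 * (exp (\<alpha> * Re w) + norm l)" by linarith
  next
    fix w :: complex assume w: "\<bar>Im w\<bar> \<le> \<theta>1"
    from c2(2)[OF w] have "c2 * (exp (Re w) + 1) \<le> norm (1 + exp w)" by (simp add: add.commute)
    moreover have "min c1 c2 * (exp (Re w) + 1) \<le> c2 * (exp (Re w) + 1)"
      by (intro mult_right_mono) (auto intro: add_nonneg_nonneg)
    ultimately show "norm (1 + exp w) \<ge> min c1 c2 * (exp (Re w) + 1)" by linarith
  qed
qed

lemma denom_nonzero: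
  assumes "\<bar>Im w\<bar> \<le> \<theta>1"
  shows "exp (of_real \<alpha> * w) - l \<noteq> 0" "1 + exp w \<noteq> 0"
proof -
  obtain c where c: "c > 0"
    "\<And>w. \<bar>Im w\<bar> \<le> \<theta>1 \<Longrightarrow> norm (exp (of_real \<alpha> * w) - l) \<ge> c * (exp (\<alpha> * Re w) + norm l)"
    "\<And>w. \<bar>Im w\<bar> \<le> \<theta>1 \<Longrightarrow> norm (1 + exp w) \<ge> c * (exp (Re w) + 1)"
    using lower_bounds by blast
  have "c * (exp (\<alpha> * Re w) + norm l) > 0" "c * (exp (Re w) + 1) > 0"
    using c(1) by (auto intro!: mult_pos_pos add_pos_nonneg)
  then show "exp (of_real \<alpha> * w) - l \<noteq> 0" "1 + exp w \<noteq> 0"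
    using c(2,3)[OF assms] by force+
qed

text \<open>Over a common denominator the numerator of \<open>H\<close> is
  \<open>l * exp w + exp (of_real \<alpha> * w)\<close>, the constants having cancelled. In terms of
  \<open>s = exp w\<close>, the function is of order \<alpha> at 0 and of order - \<alpha> at
  infinity, because \<alpha> \<le> 1 decides which term of the numerator dominates.\<close>

lemma H_bound:
  obtains C where "C \<ge> 0" "\<And>w. \<bar>Im w\<bar> \<le> \<theta>1 \<Longrightarrow> norm (H w) \<le> C * exp (- \<alpha> * \<bar>Re w\<bar>)"
proof -
  obtain c where c: "c > 0"
    "\<And>w. \<bar>Im w\<bar> \<le> \<theta>1 \<Longrightarrow> norm (exp (of_real \<alpha> * w) - l) \<ge> c * (exp (\<alpha> * Re w) + norm l)"
    "\<And>w. \<bar>Im w\<bar> \<le> \<theta>1 \<Longrightarrow> norm (1 + exp w) \<ge> c * (exp (Re w) + 1)"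
    using lower_bounds by blast
  define L where "L = norm l"
  have L: "L > 0" using l_nonzero by (simp add: L_def)
  \<comment> \<open>\<open>K\<close> is the constant for \<open>Re w \<ge> 0\<close> and
    \<open>K / L\<close> the one for \<open>Re w < 0\<close>; their sum serves for both.\<close>
  define K where "K = (L + 1) / (L * c * c)"
  have K: "K > 0" using L c by (simp add: K_def)
  show ?thesis
  proof (rule that[of "K + K / L"])
    show "K + K / L \<ge> 0" using K L by simp
    fix w :: complex assume w: "\<bar>Im w\<bar> \<le> \<theta>1"
    define X where "X = exp (Re w)"
    define Y where "Y = exp (\<alpha> * Re w)"
    have XY: "X > 0" "Y > 0" by (auto simp: X_def Y_def)
    note nz = denom_nonzero[OF w]
    have "H w = (l * exp w + exp (of_real \<alpha> * w)) / (l * (exp (of_real \<alpha> * w) - l) * (1 + exp w))"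
      unfolding H_def using nz l_nonzero by (simp add: divide_simps) (simp add: algebra_simps)
    then have "norm (H w) = norm (l * exp w + exp (of_real \<alpha> * w)) / (L * norm (exp (of_real \<alpha> * w) - l) * norm (1 + exp w))"
      by (simp add: norm_divide norm_mult L_def)
    also have "\<dots> \<le> (L * X + Y) / (L * (c * (Y + L)) * (c * (X + 1)))"
    proof (rule frac_le)
      show "norm (l * exp w + exp (of_real \<alpha> * w)) \<le> L * X + Y"
        by (rule order_trans[OF norm_triangle_ineq]) (simp add: norm_mult L_def X_def Y_def)
      show "L * (c * (Y + L)) * (c * (X + 1)) \<le> L * norm (exp (of_real \<alpha> * w) - l) * norm (1 + exp w)"
        using c(2,3)[OF w] L c(1) XY by (intro mult_mono) (auto simp: X_def Y_def L_def)
      show "0 < L * (c * (Y + L)) * (c * (X + 1))" using L c XY by simp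
      show "0 \<le> L * X + Y" using L XY by simp
    qed
    finally have *: "norm (H w) \<le> (L * X + Y) / (L * (c * (Y + L)) * (c * (X + 1)))" .
    show "norm (H w) \<le> (K + K / L) * exp (- \<alpha> * \<bar>Re w\<bar>)"
    proof (cases "Re w \<ge> 0")
      case True
      have YX: "Y \<le> X" using True \<alpha> by (auto simp: X_def Y_def intro: mult_left_le_one_le)
      have "(L * X + Y) / (L * (c * (Y + L)) * (c * (X + 1))) \<le> ((L + 1) * X) / (L * (c * Y) * (c * X))"
        using YX XY L c by (intro frac_le mult_mono) (auto simp: algebra_simps)
      also have "\<dots> = K * (1 / Y)" using XY L c by (simp add: K_def field_simps)
      also have "1 / Y = exp (- \<alpha> * \<bar>Re w\<bar>)" using True by (simp add: Y_def exp_minus divide_inverse)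
      also have "K * exp (- \<alpha> * \<bar>Re w\<bar>) \<le> (K + K / L) * exp (- \<alpha> * \<bar>Re w\<bar>)"
        using K L by (intro mult_right_mono) auto
      finally show ?thesis using * by linarith
    next
      case False
      have "Re w \<le> \<alpha> * Re w" using False \<alpha> mult_right_mono_neg[of \<alpha> 1 "Re w"] by simp
      then have YX: "X \<le> Y" by (simp add: X_def Y_def)
      have "(L * X + Y) / (L * (c * (Y + L)) * (c * (X + 1))) \<le> ((L + 1) * Y) / (L * (c * L) * (c * 1))"
        using YX XY L c by (intro frac_le mult_mono) (auto simp: algebra_simps)
      also have "\<dots> = K / L * Y" using XY L c by (simp add: K_def field_simps)
      also have "\<dots> = K / L * exp (- \<alpha> * \<bar>Re w\<bar>)" using False by (simp add: Y_def)
      also have "K / L * exp (- \<alpha> * \<bar>Re w\<bar>) \<le> (K + K / L) * exp (- \<alpha> * \<bar>Re w\<bar>)"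
        using K L by (intro mult_right_mono) auto
      finally show ?thesis using * by linarith
    qed
  qed
qed

lemma H_holomorphic: "H holomorphic_on {w. \<bar>Im w\<bar> < \<theta>1}"
  unfolding H_def
  by (intro holomorphic_intros) (use denom_nonzero l_nonzero in auto)

lemma hline_continuous [continuous_intros]: "continuous_on A (hline \<sigma>)"
  unfolding hline_def by (intro continuous_intros)

lemma H_hline_continuous: "\<bar>\<sigma>\<bar> \<le> \<theta> \<Longrightarrow> continuous_on A (\<lambda>u. H (hline \<sigma> u))"
  by (rule continuous_on_compose2[OF holomorphic_on_imp_continuous_on[OF H_holomorphic] hline_continuous])
     (use \<theta> in auto)

text \<open>The inverse Laplace integral along the ray of angle \<sigma>, without its factor 1 / (2
  pi i). The last factor \<open>exp (hline \<sigma> u)\<close> comes from \<open>ds = s du\<close>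
  under \<open>s = exp (hline \<sigma> u)\<close>.\<close>

definition q :: "real \<Rightarrow> real \<Rightarrow> complex" where
  "q \<sigma> t = (LINT u|lborel. exp (exp (hline \<sigma> u) * of_real t) * (H (hline \<sigma> u) * exp (hline \<sigma> u)))"

lemma H_hline_integrable:
  assumes "\<bar>\<sigma>\<bar> = \<theta>"
  shows "integrable lborel (\<lambda>u. H (hline \<sigma> u))"
proof -
  obtain C where C: "C \<ge> 0" "\<And>w. \<bar>Im w\<bar> \<le> \<theta>1 \<Longrightarrow> norm (H w) \<le> C * exp (- \<alpha> * \<bar>Re w\<bar>)"
    using H_bound by blast
  show ?thesis
  proof (rule Bochner_Integration.integrable_bound)
    show "integrable lborel (\<lambda>u. C * exp (- \<alpha> * \<bar>u\<bar>))"
      using exp_abs_integrable[OF \<alpha>(1)] by (rule integrable_mult_right)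
    show "(\<lambda>u. H (hline \<sigma> u)) \<in> borel_measurable lborel"
      using borel_measurable_continuous_onI[OF H_hline_continuous] assms by simp
    show "AE u in lborel. norm (H (hline \<sigma> u)) \<le> norm (C * exp (- \<alpha> * \<bar>u\<bar>))"
      using C(2)[of "hline \<sigma> _"] C(1) assms \<theta> by simp
  qed
qed

text \<open>Fubini applies because the time integral of the norm of \<open>exp ((s - z) * t)\<close>
  is at most \<open>1 / (norm s * - cos \<theta>)\<close>, and \<open>norm s\<close> cancels the
  factor contributed by \<open>ds\<close>; integrability of \<open>H\<close> along the line then
  suffices. The estimate is uniform down to \<open>z = 0\<close>, the case that makes
  \<open>r\<close> itself integrable.\<close>

lemma q_laplace:
  assumes \<sigma>: "\<bar>\<sigma>\<bar> = \<theta>" and z: "0 \<le> z"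
  shows "integrable lborel (causal (\<lambda>t. exp (- of_real z * of_real t) * q \<sigma> t))"
    and "laplace (q \<sigma>) (of_real z) = (LINT u|lborel. H (hline \<sigma> u) * exp (hline \<sigma> u) / (of_real z - exp (hline \<sigma> u)))"
proof -
  define E where "E u = exp (hline \<sigma> u)" for u
  have cs: "cos \<sigma> = cos \<theta>" using \<sigma> cos_abs_real[of \<sigma>] by simp
  have ReE: "Re (E u) = exp u * cos \<theta>" for u by (simp add: E_def Re_exp cs)
  have nE: "norm (E u) = exp u" for u by (simp add: E_def)
  define c where "c u = E u - of_real z" for u
  have Rec: "Re (c u) < 0" for u
  proof -
    have "exp u * cos \<theta> < 0" using cos_\<theta> by (simp add: mult_pos_neg)
    then show ?thesis using z by (simp add: c_def ReE)
  qed
  have Hm[measurable]: "(\<lambda>u. H (hline \<sigma> u)) \<in> borel_measurable borel"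
    using borel_measurable_continuous_onI[OF H_hline_continuous] \<sigma> by simp
  have Em[measurable]: "E \<in> borel_measurable borel"
    unfolding E_def by (intro borel_measurable_continuous_onI continuous_intros)
  define f where "f u t = causal (\<lambda>t. exp (c u * of_real t)) t * (H (hline \<sigma> u) * E u)" for u t
  have fm: "case_prod f \<in> borel_measurable (lborel \<Otimes>\<^sub>M lborel)"
    unfolding f_def causal_def c_def by measurable
  have ni: "(LINT t|lborel. norm (f u t)) = norm (H (hline \<sigma> u)) * (exp u / - Re (c u))" for u
    unfolding f_def norm_mult using causal_exp_norm_integral[OF Rec[of u]] by (simp add: nE)
  have nb: "exp u / - Re (c u) \<le> 1 / - cos \<theta>" for u
  proof -
    define D where "D = - (exp u * cos \<theta>)"
    have D: "D > 0" using cos_\<theta> by (simp add: D_def mult_pos_neg)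
    have "- Re (c u) = D + z" by (simp add: D_def c_def ReE)
    then have "exp u / - Re (c u) \<le> exp u / D"
      using z D by (auto intro!: divide_left_mono mult_pos_pos)
    then have "exp u / - Re (c u) \<le> exp u / (- (exp u * cos \<theta>))" by (simp add: D_def)
    then show ?thesis by simp
  qed
  have int: "integrable (lborel \<Otimes>\<^sub>M lborel) (case_prod f)"
  proof (rule lborel_pair.Fubini_integrable[OF fm])
    have "integrable lborel (\<lambda>u. norm (H (hline \<sigma> u)) * (exp u / - Re (c u)))"
    proof (rule Bochner_Integration.integrable_bound)
      show "integrable lborel (\<lambda>u. norm (H (hline \<sigma> u)) * (1 / - cos \<theta>))"
        using H_hline_integrable[OF \<sigma>] by simp
      show "(\<lambda>u. norm (H (hline \<sigma> u)) * (exp u / - Re (c u))) \<in> borel_measurable lborel"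
        unfolding c_def by measurable
      have "norm (norm (H (hline \<sigma> u)) * (exp u / - Re (c u))) \<le> norm (norm (H (hline \<sigma> u)) * (1 / - cos \<theta>))" for u
      proof -
        have "norm (norm (H (hline \<sigma> u)) * (exp u / - Re (c u))) = norm (H (hline \<sigma> u)) * (exp u / - Re (c u))"
          using Rec[of u] by (simp add: abs_mult)
        also have "\<dots> \<le> norm (H (hline \<sigma> u)) * (1 / - cos \<theta>)" using nb by (intro mult_left_mono) auto
        also have "\<dots> \<le> norm (norm (H (hline \<sigma> u)) * (1 / - cos \<theta>))" by (simp only: real_norm_def abs_ge_self)
        finally show ?thesis .
      qed
      then show "AE u in lborel. norm (norm (H (hline \<sigma> u)) * (exp u / - Re (c u))) \<le> norm (norm (H (hline \<sigma> u)) * (1 / - cos \<theta>))"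
        by simp
    qed
    then show "integrable lborel (\<lambda>u. LINT t|lborel. norm (case (u, t) of (u, t) \<Rightarrow> f u t))"
      by (simp add: ni)
    show "AE u in lborel. integrable lborel (\<lambda>t. case (u, t) of (u, t) \<Rightarrow> f u t)"
      using causal_exp_integrable[OF Rec] by (simp add: f_def)
  qed
  have inner: "(LINT u|lborel. f u t) = causal (\<lambda>t. exp (- of_real z * of_real t) * q \<sigma> t) t" for t
  proof (cases "0 \<le> t")
    case True
    have "(LINT u|lborel. f u t) = (LINT u|lborel. exp (- of_real z * of_real t) * (exp (exp (hline \<sigma> u) * of_real t) * (H (hline \<sigma> u) * exp (hline \<sigma> u))))"
      by (rule Bochner_Integration.integral_cong)
         (use True in \<open>auto simp: f_def causal_def c_def E_def left_diff_distrib exp_diff exp_minus field_simps\<close>)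
    then show ?thesis using True by (simp add: q_def causal_def)
  qed (simp add: f_def causal_def)
  show "integrable lborel (causal (\<lambda>t. exp (- of_real z * of_real t) * q \<sigma> t))"
    using lborel_pair.integrable_snd[OF int] by (simp add: inner)
  have "laplace (q \<sigma>) (of_real z) = (LINT t|lborel. LINT u|lborel. f u t)"
    unfolding laplace_def inner ..
  also have "\<dots> = (LINT u|lborel. LINT t|lborel. f u t)" by (rule lborel_pair.Fubini_integral[OF int])
  also have "\<dots> = (LINT u|lborel. H (hline \<sigma> u) * exp (hline \<sigma> u) / (of_real z - exp (hline \<sigma> u)))"
  proof (rule Bochner_Integration.integral_cong)
    fix u
    have "c u \<noteq> 0" using Rec[of u] by auto
    then have "of_real z - E u \<noteq> 0" by (simp add: c_def)
    then have "- 1 / c u = 1 / (of_real z - E u)" using \<open>c u \<noteq> 0\<close> by (simp add: c_def field_simps)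
    moreover have "(LINT t|lborel. f u t) = (- 1 / c u) * (H (hline \<sigma> u) * E u)"
      unfolding f_def using causal_exp_integral[OF Rec[of u]] by simp
    ultimately show "(LINT t|lborel. f u t) = H (hline \<sigma> u) * exp (hline \<sigma> u) / (of_real z - exp (hline \<sigma> u))"
      by (simp add: E_def)
  qed simp
  finally show "laplace (q \<sigma>) (of_real z) = (LINT u|lborel. H (hline \<sigma> u) * exp (hline \<sigma> u) / (of_real z - exp (hline \<sigma> u)))" .
qed

text \<open>The integrand has one pole in the strip, at \<open>ln z\<close>, with residue
  \<open>- H (ln z)\<close>. A counterclockwise rectangle runs along the lower line to the right and
  along the upper one to the left, which accounts for the sign. The exponential decay of
  \<open>H\<close> removes the vertical edges in the limit.\<close>

lemma cauchy_strip:
  assumes z: "0 < z"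
  shows "(LINT u|lborel. H (hline \<theta> u) * exp (hline \<theta> u) / (of_real z - exp (hline \<theta> u)))
       - (LINT u|lborel. H (hline (-\<theta>) u) * exp (hline (-\<theta>) u) / (of_real z - exp (hline (-\<theta>) u)))
       = 2 * of_real pi * \<i> * H (of_real (ln z))"
proof -
  define w0 where "w0 = complex_of_real (ln z)"
  define \<Phi> where "\<Phi> w = H w * exp w / (of_real z - exp w)" for w
  define S where "S = {w. \<bar>Im w\<bar> < \<theta>1}"
  have S: "S = {w. - \<theta>1 < Im w} \<inter> {w. Im w < \<theta>1}" by (auto simp: S_def)
  have oS: "open S" unfolding S by (intro open_Int open_halfspace_Im_gt open_halfspace_Im_lt)
  have cS: "connected S" unfolding S
    by (intro convex_connected convex_Int convex_halfspace_Im_gt convex_halfspace_Im_lt)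
  have ew0: "exp w0 = of_real z" using z by (simp add: w0_def exp_of_real)
  have w0S: "w0 \<in> S" using \<theta>_pos by (simp add: S_def w0_def)
  \<comment> \<open>The strip has height less than 2 * pi on either side of the real axis, so
    \<open>exp\<close> takes the value \<open>z\<close> in it only at \<open>w0\<close>.\<close>
  have nz: "of_real z - exp w \<noteq> 0" if "w \<in> S" "w \<noteq> w0" for w
  proof
    assume "of_real z - exp w = 0"
    then have e: "exp w = exp w0" using ew0 by simp
    have "\<bar>Im w - Im w0\<bar> < 2 * pi" using that(1) \<theta> by (auto simp: S_def w0_def)
    then have "w = w0" using e by (rule exp_complex_eqI)
    then show False using that by simp
  qed
  have holH: "H holomorphic_on S" using H_holomorphic by (simp add: S_def)
  have hol\<Phi>: "\<Phi> holomorphic_on S - {w0}"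
    unfolding \<Phi>_def by (intro holomorphic_intros holomorphic_on_subset[OF holH]) (use nz in auto)
  have res: "residue \<Phi> w0 = - H w0"
  proof (rule residue_simple'[OF oS w0S hol\<Phi>])
    have "((\<lambda>w. (exp w - exp w0) / (w - w0)) \<longlongrightarrow> exp w0) (at w0)"
      using DERIV_exp[of w0] by (simp add: has_field_derivative_iff)
    moreover have "(H \<longlongrightarrow> H w0) (at w0)"
      using holH oS w0S holomorphic_on_imp_continuous_on continuous_on_eq_continuous_at isCont_def by blast
    ultimately have "((\<lambda>w. - (H w * exp w / ((exp w - exp w0) / (w - w0)))) \<longlongrightarrow> - (H w0 * exp w0 / exp w0)) (at w0)"
      by (intro tendsto_intros) auto
    then have "((\<lambda>w. - (H w * exp w / ((exp w - exp w0) / (w - w0)))) \<longlongrightarrow> - H w0) (at w0)" by simp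
    moreover have "- (H w * exp w / ((exp w - exp w0) / (w - w0))) = \<Phi> w * (w - w0)" for w
    proof -
      have "of_real z - exp w = - (exp w - exp w0)" by (simp add: ew0)
      then show ?thesis unfolding \<Phi>_def by (simp add: ew0 minus_divide_right)
    qed
    ultimately show "((\<lambda>w. \<Phi> w * (w - w0)) \<longlongrightarrow> - H w0) (at w0)" by simp
  qed
  obtain C where C: "C \<ge> 0" "\<And>w. \<bar>Im w\<bar> \<le> \<theta>1 \<Longrightarrow> norm (H w) \<le> C * exp (- \<alpha> * \<bar>Re w\<bar>)"
    using H_bound by blast
  have ray_int: "integrable lborel (\<lambda>u. \<Phi> (hline \<sigma> u))" if \<sigma>: "\<bar>\<sigma>\<bar> = \<theta>" for \<sigma>
  proof (rule Bochner_Integration.integrable_bound)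
    show "integrable lborel (\<lambda>u. norm (H (hline \<sigma> u)) * (1 / - cos \<theta>))"
      using H_hline_integrable[OF \<sigma>] by simp
    have "hline \<sigma> u \<in> S - {w0}" for u using \<sigma> \<theta> \<theta>_pos by (auto simp: S_def w0_def complex_eq_iff)
    then have "continuous_on UNIV (\<lambda>u. \<Phi> (hline \<sigma> u))"
      by (intro continuous_on_compose2[OF holomorphic_on_imp_continuous_on[OF hol\<Phi>] hline_continuous]) auto
    then show "(\<lambda>u. \<Phi> (hline \<sigma> u)) \<in> borel_measurable lborel"
      using borel_measurable_continuous_onI by simp
    have cs: "cos \<sigma> = cos \<theta>" using \<sigma> cos_abs_real[of \<sigma>] by simp
    have "norm (\<Phi> (hline \<sigma> u)) \<le> norm (norm (H (hline \<sigma> u)) * (1 / - cos \<theta>))" for u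
    proof -
      define D where "D = - (exp u * cos \<theta>)"
      have D: "D > 0" using cos_\<theta> by (simp add: D_def mult_pos_neg)
      have "D + z = Re (of_real z - exp (hline \<sigma> u))" by (simp add: D_def Re_exp cs)
      also have "\<dots> \<le> norm (of_real z - exp (hline \<sigma> u))" by (rule complex_Re_le_cmod)
      finally have "exp u / norm (of_real z - exp (hline \<sigma> u)) \<le> exp u / D"
        using z D by (auto intro!: divide_left_mono mult_pos_pos)
      then have "exp u / norm (of_real z - exp (hline \<sigma> u)) \<le> 1 / - cos \<theta>" by (simp add: D_def)
      then have "norm (H (hline \<sigma> u)) * (exp u / norm (of_real z - exp (hline \<sigma> u))) \<le> norm (H (hline \<sigma> u)) * (1 / - cos \<theta>)"
        by (rule mult_left_mono) simp
      also have "\<dots> \<le> norm (norm (H (hline \<sigma> u)) * (1 / - cos \<theta>))" by (simp only: real_norm_def abs_ge_self)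
      finally show ?thesis by (simp add: \<Phi>_def norm_mult norm_divide)
    qed
    then show "AE u in lborel. norm (\<Phi> (hline \<sigma> u)) \<le> norm (norm (H (hline \<sigma> u)) * (1 / - cos \<theta>))" by simp
  qed
  have ray_lim: "(\<lambda>n. integral {- real n..real n} (\<lambda>u. \<Phi> (hline \<sigma> u))) \<longlonglongrightarrow> (LINT u|lborel. \<Phi> (hline \<sigma> u))"
    if \<sigma>: "\<bar>\<sigma>\<bar> = \<theta>" for \<sigma>
  proof -
    note i = ray_int[OF \<sigma>]
    have "(\<lambda>n. LINT u|lborel. indicator {- real n..real n} u *\<^sub>R \<Phi> (hline \<sigma> u)) \<longlonglongrightarrow> (LINT u|lborel. \<Phi> (hline \<sigma> u))"
    proof (rule integral_dominated_convergence[where w="\<lambda>u. norm (\<Phi> (hline \<sigma> u))"])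
      show "(\<lambda>u. \<Phi> (hline \<sigma> u)) \<in> borel_measurable lborel" using i by (rule borel_measurable_integrable)
      then show "(\<lambda>u. indicator {- real n..real n} u *\<^sub>R \<Phi> (hline \<sigma> u)) \<in> borel_measurable lborel" for n by measurable
      show "AE u in lborel. norm (indicator {- real n..real n} u *\<^sub>R \<Phi> (hline \<sigma> u)) \<le> norm (\<Phi> (hline \<sigma> u))" for n
        by (auto simp: indicator_def)
      have "(\<lambda>n. indicator {- real n..real n} u *\<^sub>R \<Phi> (hline \<sigma> u)) \<longlonglongrightarrow> \<Phi> (hline \<sigma> u)" for u
      proof (rule tendsto_eventually)
        show "eventually (\<lambda>n. indicator {- real n..real n} u *\<^sub>R \<Phi> (hline \<sigma> u) = \<Phi> (hline \<sigma> u)) sequentially"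
          using eventually_ge_at_top[of "nat \<lceil>\<bar>u\<bar>\<rceil>"]
        proof eventually_elim
          case (elim n)
          then have "\<bar>u\<bar> \<le> real n" by linarith
          then have "u \<in> {- real n..real n}" by auto
          then show ?case by simp
        qed
      qed
      then show "AE u in lborel. (\<lambda>n. indicator {- real n..real n} u *\<^sub>R \<Phi> (hline \<sigma> u)) \<longlonglongrightarrow> \<Phi> (hline \<sigma> u)" by simp
    qed (use i in auto)
    moreover have "(LINT u|lborel. indicator {- real n..real n} u *\<^sub>R \<Phi> (hline \<sigma> u)) = integral {- real n..real n} (\<lambda>u. \<Phi> (hline \<sigma> u))" for n
    proof -
      have "set_integrable lborel {- real n..real n} (\<lambda>u. \<Phi> (hline \<sigma> u))"
        unfolding set_integrable_def using integrable_mult_indicator[OF _ i, of "{- real n..real n}"] by simp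
      from set_borel_integral_eq_integral(2)[OF this] show ?thesis
        by (simp add: set_lebesgue_integral_def)
    qed
    ultimately show ?thesis by simp
  qed
  \<comment> \<open>Beyond \<open>\<bar>ln z\<bar> + 1\<close> the moduli of \<open>exp w\<close>
    and \<open>z\<close> differ at least by the factor \<open>exp 1 \<ge> 2\<close>, which bounds
    \<open>exp w / (z - exp w)\<close> by 2 on the vertical edges.\<close>
  define n0 where "n0 = nat \<lceil>\<bar>ln z\<bar> + 1\<rceil>"
  have n0: "\<bar>ln z\<bar> + 1 \<le> real n" if "n \<ge> n0" for n using that unfolding n0_def by linarith
  have edge: "norm (\<Phi> w) \<le> 2 * C * exp (- \<alpha> * real n)"
    if n: "n \<ge> n0" and w: "\<bar>Re w\<bar> = real n" "\<bar>Im w\<bar> \<le> \<theta>" for n w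
  proof -
    have two: "(2::real) \<le> exp 1" using exp_ge_add_one_self[of 1] by simp
    have "norm (exp w / (of_real z - exp w)) \<le> 2"
    proof (cases "Re w \<ge> 0")
      case True
      then have "ln z + 1 \<le> Re w" using n0[OF n] w by linarith
      then have "exp (ln z + 1) \<le> exp (Re w)" by simp
      then have "z * exp 1 \<le> exp (Re w)" using z by (simp add: exp_add)
      moreover have "z * 2 \<le> z * exp 1" using two z by (intro mult_left_mono) auto
      ultimately have "2 * z \<le> exp (Re w)" by linarith
      moreover have "norm (exp w) - z \<le> norm (of_real z - exp w)"
        using norm_triangle_ineq2[of "exp w" "of_real z"] z by (simp add: norm_minus_commute)
      ultimately have "exp (Re w) \<le> 2 * norm (of_real z - exp w)" by simp
      then show ?thesis by (cases "of_real z - exp w = 0") (auto simp: norm_divide divide_le_eq)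
    next
      case False
      then have "Re w + 1 \<le> ln z" using n0[OF n] w by linarith
      then have "exp (Re w + 1) \<le> exp (ln z)" by simp
      then have "exp (Re w) * exp 1 \<le> z" using z by (simp add: exp_add)
      moreover have "exp (Re w) * 2 \<le> exp (Re w) * exp 1" using two by (intro mult_left_mono) auto
      ultimately have "2 * exp (Re w) \<le> z" by linarith
      moreover have "z - norm (exp w) \<le> norm (of_real z - exp w)"
        using norm_triangle_ineq2[of "of_real z" "exp w"] z by simp
      ultimately have "exp (Re w) \<le> 2 * norm (of_real z - exp w)"
        using norm_ge_zero[of "of_real z - exp w"] unfolding norm_exp_eq_Re by linarith
      then show ?thesis by (cases "of_real z - exp w = 0") (auto simp: norm_divide divide_le_eq)
    qed
    then have "norm (H w) * norm (exp w / (of_real z - exp w)) \<le> (C * exp (- \<alpha> * real n)) * 2"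
      using C(2)[of w] w \<theta> C(1) by (intro mult_mono) auto
    then show ?thesis by (simp add: \<Phi>_def norm_mult norm_divide)
  qed
  have edge_lim: "(\<lambda>n. contour_integral (linepath (a n) (b n)) \<Phi>) \<longlonglongrightarrow> 0"
    if ab: "\<And>n. \<bar>Re (a n)\<bar> = real n" "\<And>n. Re (b n) = Re (a n)" "\<And>n. \<bar>Im (a n)\<bar> = \<theta>" "\<And>n. \<bar>Im (b n)\<bar> = \<theta>" for a b :: "nat \<Rightarrow> complex"
  proof (rule Lim_null_comparison)
    have seg: "\<bar>Re w\<bar> = real n \<and> \<bar>Im w\<bar> \<le> \<theta>" if "w \<in> closed_segment (a n) (b n)" for w n
    proof -
      have "Re w \<in> closed_segment (Re (a n)) (Re (b n))" "Im w \<in> closed_segment (Im (a n)) (Im (b n))"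
        using that unfolding closed_segment_def by force+
      then show ?thesis using ab[of n] by (auto simp: closed_segment_eq_real_ivl split: if_splits)
    qed
    show "eventually (\<lambda>n. norm (contour_integral (linepath (a n) (b n)) \<Phi>) \<le> 2 * C * exp (- \<alpha> * real n) * (2 * \<theta>)) sequentially"
      using eventually_ge_at_top[of n0]
    proof eventually_elim
      case (elim n)
      have sub: "closed_segment (a n) (b n) \<subseteq> S - {w0}"
      proof
        fix w assume w: "w \<in> closed_segment (a n) (b n)"
        have "Re w \<noteq> ln z" using seg[OF w] n0[OF elim] by auto
        then show "w \<in> S - {w0}" using seg[OF w] \<theta> by (auto simp: S_def w0_def)
      qed
      have "\<Phi> contour_integrable_on linepath (a n) (b n)"
        by (intro contour_integrable_continuous_linepath continuous_on_subset[OF holomorphic_on_imp_continuous_on[OF hol\<Phi>] sub])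
      then have hc: "(\<Phi> has_contour_integral contour_integral (linepath (a n) (b n)) \<Phi>) (linepath (a n) (b n))"
        by (rule has_contour_integral_integral)
      have "norm (contour_integral (linepath (a n) (b n)) \<Phi>) \<le> 2 * C * exp (- \<alpha> * real n) * norm (b n - a n)"
        by (rule has_contour_integral_bound_linepath[OF hc]) (use seg edge[OF elim] C in auto)
      also have "norm (b n - a n) \<le> 2 * \<theta>"
        using ab(2-4)[of n] by (simp add: cmod_eq_Im)
      finally show ?case using C by (simp add: mult_left_mono)
    qed
    have "(\<lambda>n. exp (- \<alpha> * real n)) \<longlonglongrightarrow> 0" using \<alpha>(1) by real_asymp
    from tendsto_mult[OF tendsto_mult[OF tendsto_const[of "2 * C"] this] tendsto_const[of "2 * \<theta>"]]
    show "(\<lambda>n. 2 * C * exp (- \<alpha> * real n) * (2 * \<theta>)) \<longlonglongrightarrow> 0"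
      by simp
  qed
  have rect: "integral {- real n..real n} (\<lambda>u. \<Phi> (hline (-\<theta>) u)) + contour_integral (linepath (hline (-\<theta>) n) (hline \<theta> n)) \<Phi>
      - integral {- real n..real n} (\<lambda>u. \<Phi> (hline \<theta> u)) + contour_integral (linepath (hline \<theta> (- real n)) (hline (-\<theta>) (- real n))) \<Phi>
      = - 2 * of_real pi * \<i> * H w0" if n: "n \<ge> n0" for n
  proof -
    have n1: "real n \<ge> 1" using n0[OF n] by linarith
    let ?g = "rectpath (hline (-\<theta>) (- real n)) (hline \<theta> n)"
    have pts: "Complex (Re (hline \<theta> n)) (Im (hline (-\<theta>) (- real n))) = hline (-\<theta>) n"
       "Complex (Re (hline (-\<theta>) (- real n))) (Im (hline \<theta> n)) = hline \<theta> (- real n)"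
      by (simp_all add: complex_eq_iff)
    have pi: "path_image ?g \<subseteq> S - {w0}"
    proof -
      have "path_image ?g \<subseteq> cbox (hline (-\<theta>) (- real n)) (hline \<theta> n) - box (hline (-\<theta>) (- real n)) (hline \<theta> n)"
        using \<theta>_pos by (subst path_image_rectpath_cbox_minus_box) auto
      moreover have "cbox (hline (-\<theta>) (- real n)) (hline \<theta> n) \<subseteq> S" using \<theta> by (auto simp: in_cbox_complex_iff S_def)
      moreover have "w0 \<in> box (hline (-\<theta>) (- real n)) (hline \<theta> n)" using n0[OF n] \<theta>_pos by (auto simp: in_box_complex_iff w0_def)
      ultimately show ?thesis by blast
    qed
    have "contour_integral ?g \<Phi> = 2 * pi * \<i> * (\<Sum>p\<in>{w0}. winding_number ?g p * residue \<Phi> p)"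
    proof (rule Residue_theorem[OF oS cS _ hol\<Phi> _ _ pi])
      show "\<forall>z. z \<notin> S \<longrightarrow> winding_number ?g z = 0"
        using \<theta> \<theta>_pos n1 by (auto intro!: winding_number_rectpath_outside simp: in_cbox_complex_iff S_def)
    qed auto
    moreover have "winding_number ?g w0 = 1"
      using n0[OF n] \<theta>_pos by (intro winding_number_rectpath) (auto simp: in_box_complex_iff w0_def)
    ultimately have R: "contour_integral ?g \<Phi> = - 2 * of_real pi * \<i> * H w0" by (simp add: res)
    have c: "continuous_on (path_image ?g) \<Phi>"
      by (rule continuous_on_subset[OF holomorphic_on_imp_continuous_on[OF hol\<Phi>] pi])
    have P: "path_image ?g = closed_segment (hline (-\<theta>) (- real n)) (hline (-\<theta>) n) \<union> (closed_segment (hline (-\<theta>) n) (hline \<theta> n)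
      \<union> (closed_segment (hline \<theta> n) (hline \<theta> (- real n)) \<union> closed_segment (hline \<theta> (- real n)) (hline (-\<theta>) (- real n))))"
      unfolding rectpath_def Let_def pts by (simp add: path_image_join)
    have ci0: "\<Phi> contour_integrable_on linepath p p'" if "closed_segment p p' \<subseteq> path_image ?g" for p p'
      by (intro contour_integrable_continuous_linepath continuous_on_subset[OF c that])
    have ci: "\<Phi> contour_integrable_on linepath (hline (-\<theta>) (- real n)) (hline (-\<theta>) n)"
       "\<Phi> contour_integrable_on linepath (hline (-\<theta>) n) (hline \<theta> n)"
       "\<Phi> contour_integrable_on linepath (hline \<theta> n) (hline \<theta> (- real n))"
       "\<Phi> contour_integrable_on linepath (hline \<theta> (- real n)) (hline (-\<theta>) (- real n))"
      by (rule ci0, force simp: P)+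
    have "contour_integral ?g \<Phi> = contour_integral (linepath (hline (-\<theta>) (- real n)) (hline (-\<theta>) n)) \<Phi>
      + (contour_integral (linepath (hline (-\<theta>) n) (hline \<theta> n)) \<Phi>
      + (contour_integral (linepath (hline \<theta> n) (hline \<theta> (- real n))) \<Phi>
      + contour_integral (linepath (hline \<theta> (- real n)) (hline (-\<theta>) (- real n))) \<Phi>))"
      unfolding rectpath_def Let_def pts using ci by (simp add: contour_integral_join contour_integrable_joinI)
    moreover have "contour_integral (linepath (hline \<theta> n) (hline \<theta> (- real n))) \<Phi> = - contour_integral (linepath (hline \<theta> (- real n)) (hline \<theta> n)) \<Phi>"
      using contour_integral_reversepath[of "linepath (hline \<theta> (- real n)) (hline \<theta> n)" \<Phi>] by simp
    ultimately show ?thesis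
      using R n1 contour_integral_horizontal[of "- real n" "real n"] by (simp add: algebra_simps)
  qed
  let ?I = "\<lambda>\<sigma>. LINT u|lborel. \<Phi> (hline \<sigma> u)"
  have "(\<lambda>n. integral {- real n..real n} (\<lambda>u. \<Phi> (hline (-\<theta>) u)) + contour_integral (linepath (hline (-\<theta>) n) (hline \<theta> n)) \<Phi>
      - integral {- real n..real n} (\<lambda>u. \<Phi> (hline \<theta> u)) + contour_integral (linepath (hline \<theta> (- real n)) (hline (-\<theta>) (- real n))) \<Phi>)
      \<longlonglongrightarrow> ?I (-\<theta>) + 0 - ?I \<theta> + 0"
    by (intro tendsto_intros ray_lim edge_lim) (use \<theta>_pos in auto)
  moreover have "(\<lambda>n. integral {- real n..real n} (\<lambda>u. \<Phi> (hline (-\<theta>) u)) + contour_integral (linepath (hline (-\<theta>) n) (hline \<theta> n)) \<Phi>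
      - integral {- real n..real n} (\<lambda>u. \<Phi> (hline \<theta> u)) + contour_integral (linepath (hline \<theta> (- real n)) (hline (-\<theta>) (- real n))) \<Phi>)
      \<longlonglongrightarrow> - 2 * of_real pi * \<i> * H w0"
    by (rule tendsto_eventually) (use rect eventually_sequentially in blast)
  ultimately have "?I (-\<theta>) + 0 - ?I \<theta> + 0 = - 2 * of_real pi * \<i> * H w0"
    using LIMSEQ_unique by blast
  then have "?I \<theta> - ?I (-\<theta>) = 2 * of_real pi * \<i> * H w0" by (simp add: algebra_simps)
  then show ?thesis by (simp add: \<Phi>_def w0_def)
qed

text \<open>The exponential undoes the correction inside \<open>H\<close>: its transform is
  \<open>- 1 / (l * (1 + z))\<close>. The difference of the two ray integrals inverts
  \<open>H\<close>.\<close>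

definition r :: "real \<Rightarrow> complex" where
  "r t = (- 1 / l) * exp (- of_real t) + (1 / (2 * of_real pi * \<i>)) * (q \<theta> t + (- 1) * q (-\<theta>) t)"

lemma r_laplace:
  assumes z: "0 \<le> z"
  shows "integrable lborel (causal (\<lambda>t. exp (- of_real z * of_real t) * r t))"
    and "0 < z \<Longrightarrow> laplace r (of_real z) = 1 / (of_real (z powr \<alpha>) - l)"
proof -
  have \<theta>a: "\<bar>\<theta>\<bar> = \<theta>" "\<bar>-\<theta>\<bar> = \<theta>" using \<theta>_pos by auto
  have E: "exp (- of_real z * of_real t) * exp (- complex_of_real t) = exp ((- of_real z - 1) * of_real t)" for t
    by (simp add: exp_add[symmetric] left_diff_distrib)
  have e: "integrable lborel (causal (\<lambda>t. exp (- of_real z * of_real t) * exp (- complex_of_real t)))"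
    unfolding E by (rule causal_exp_integrable) (use z in simp)
  have m: "integrable lborel (causal (\<lambda>t. exp (- of_real z * of_real t) * (c * f t)))"
    if "integrable lborel (causal (\<lambda>t. exp (- of_real z * of_real t) * f t))" for c f
  proof -
    have "causal (\<lambda>t. exp (- of_real z * of_real t) * (c * f t)) = (\<lambda>t. c * causal (\<lambda>t. exp (- of_real z * of_real t) * f t) t)"
      by (auto simp: causal_def)
    then show ?thesis using that by simp
  qed
  have a: "integrable lborel (causal (\<lambda>t. exp (- of_real z * of_real t) * (f t + g t)))"
    if "integrable lborel (causal (\<lambda>t. exp (- of_real z * of_real t) * f t))"
       "integrable lborel (causal (\<lambda>t. exp (- of_real z * of_real t) * g t))" for f g
  proof -
    have "causal (\<lambda>t. exp (- of_real z * of_real t) * (f t + g t)) =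
     (\<lambda>t. causal (\<lambda>t. exp (- of_real z * of_real t) * f t) t + causal (\<lambda>t. exp (- of_real z * of_real t) * g t) t)"
      by (auto simp: causal_def algebra_simps)
    then show ?thesis using that by simp
  qed
  note qi = q_laplace(1)[OF \<theta>a(1) z] q_laplace(1)[OF \<theta>a(2) z]
  have qq: "integrable lborel (causal (\<lambda>t. exp (- of_real z * of_real t) * (q \<theta> t + (- 1) * q (-\<theta>) t)))"
    by (intro a m qi)
  show "integrable lborel (causal (\<lambda>t. exp (- of_real z * of_real t) * r t))"
    unfolding r_def by (intro a m e qi)
  assume z: "0 < z"
  have ze: "z \<ge> 0" using z by simp
  have le: "laplace (\<lambda>t. exp (- complex_of_real t)) (of_real z) = 1 / (1 + of_real z)"
  proof -
    have "laplace (\<lambda>t. exp (- complex_of_real t)) (of_real z) = (LINT t|lborel. causal (\<lambda>t. exp ((- of_real z - 1) * of_real t)) t)"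
      unfolding laplace_def E ..
    also have "\<dots> = - 1 / (- of_real z - 1)" by (rule causal_exp_integral) (use z in simp)
    also have "- complex_of_real z - 1 = - (1 + of_real z)" by simp
    also have "- 1 / - (1 + complex_of_real z) = 1 / (1 + of_real z)" by (rule minus_divide_divide)
    finally show ?thesis .
  qed
  have "laplace r (of_real z) = (- 1 / l) * (1 / (1 + of_real z)) + (1 / (2 * of_real pi * \<i>)) * (laplace (q \<theta>) (of_real z) + (- 1) * laplace (q (-\<theta>)) (of_real z))"
    unfolding r_def laplace_add[OF m[OF e] m[OF qq]] laplace_cmult laplace_add[OF qi(1) m[OF qi(2)]] le ..
  also have "laplace (q \<theta>) (of_real z) + (- 1) * laplace (q (-\<theta>)) (of_real z) = 2 * of_real pi * \<i> * H (of_real (ln z))"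
    unfolding q_laplace(2)[OF \<theta>a(1) ze] q_laplace(2)[OF \<theta>a(2) ze] cauchy_strip[OF z, symmetric] by simp
  also have "(1 / (2 * of_real pi * \<i>)) * (2 * of_real pi * \<i> * H (of_real (ln z))) = H (of_real (ln z))" by simp
  also have "H (of_real (ln z)) = 1 / (of_real (z powr \<alpha>) - l) + (1 / l) * (1 / (1 + of_real z))"
  proof -
    have "exp (complex_of_real \<alpha> * of_real (ln z)) = of_real (z powr \<alpha>)"
      using z by (simp add: powr_def exp_of_real[symmetric] del: exp_of_real)
    moreover have "exp (complex_of_real (ln z)) = of_real z" using z by (simp add: exp_of_real)
    ultimately show ?thesis by (simp add: H_def)
  qed
  finally show "laplace r (of_real z) = 1 / (of_real (z powr \<alpha>) - l)" by simp
qed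

end

lemma resolvent_exists:
  assumes "0 < \<alpha>" "\<alpha> \<le> 1" "\<alpha> * pi / 2 < \<bar>Arg l\<bar>"
  obtains r where "integrable lborel (causal r)"
    "\<And>z. 0 < z \<Longrightarrow> integrable lborel (causal (\<lambda>t. exp (- of_real z * of_real t) * r t))"
    "\<And>z. 0 < z \<Longrightarrow> laplace r (of_real z) = 1 / (of_real (z powr \<alpha>) - l)"
proof -
  \<comment> \<open>The angles must lie strictly between pi / 2 and \<open>m\<close>, and this
    interval is nonempty exactly under the condition on \<open>Arg l\<close>.\<close>
  define m where "m = min pi (\<bar>Arg l\<bar> / \<alpha>)"
  have m: "pi / 2 < m" using assms by (auto simp: m_def field_simps)
  obtain \<theta> where \<theta>: "pi / 2 < \<theta>" "\<theta> < m" using m dense by blast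
  obtain \<theta>1 where \<theta>1: "\<theta> < \<theta>1" "\<theta>1 < m" using \<theta> dense by blast
  interpret sector l \<alpha> \<theta> \<theta>1
    by unfold_locales (use assms \<theta> \<theta>1 in \<open>auto simp: m_def field_simps\<close>)
  show ?thesis
    using that[of r] r_laplace(1)[of 0] r_laplace by simp
qed

section \<open>Stability\<close>

lemma continuous_tendsto_bounded:
  fixes g :: "real \<Rightarrow> 'a::real_normed_vector"
  assumes g: "continuous_on {0..} g" and lim: "(g \<longlongrightarrow> L) at_top"
  obtains B where "B \<ge> 0" "\<And>t. 0 \<le> t \<Longrightarrow> norm (g t) \<le> B"
proof -
  have "eventually (\<lambda>t. dist (g t) L < 1) at_top" using lim by (rule tendstoD) simp
  then obtain T where T: "\<And>t. T \<le> t \<Longrightarrow> dist (g t) L < 1" by (auto simp: eventually_at_top_linorder)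
  have "compact (g ` {0..T})"
    by (intro compact_continuous_image continuous_on_subset[OF g]) auto
  then obtain B1 where B1: "\<And>t. t \<in> {0..T} \<Longrightarrow> norm (g t) \<le> B1"
    using compact_imp_bounded[of "g ` {0..T}"] unfolding bounded_iff by blast
  show ?thesis
  proof (rule that[of "max B1 (norm L + 1)"])
    show "max B1 (norm L + 1) \<ge> 0" by (simp add: le_max_iff_disj)
    fix t :: real assume t: "0 \<le> t"
    show "norm (g t) \<le> max B1 (norm L + 1)"
    proof (cases "t \<le> T")
      case True then show ?thesis using B1[of t] t by (simp add: le_max_iff_disj)
    next
      case False
      then have "norm (g t - L) < 1" using T[of t] by (simp add: dist_norm)
      then show ?thesis using norm_triangle_ineq[of "g t - L" L] by (simp add: le_max_iff_disj)
    qed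
  qed
qed

text \<open>The mass is the limit of the transform as \<open>z\<close> decreases to 0, with
  \<open>norm (causal r t)\<close> as the dominating function.\<close>

lemma resolvent_total_mass:
  assumes \<alpha>: "0 < \<alpha>" and r: "integrable lborel (causal r)"
    and L: "\<And>z. 0 < z \<Longrightarrow> laplace r (of_real z) = 1 / (of_real (z powr \<alpha>) - l)" and l: "l \<noteq> 0"
  shows "(LINT t|lborel. causal r t) = - 1 / l"
proof -
  define z where "z n = 1 / real (Suc n)" for n
  have z0: "z n > 0" for n by (simp add: z_def)
  have zl: "z \<longlonglongrightarrow> 0" unfolding z_def by (rule LIMSEQ_Suc[OF lim_1_over_n])
  have "(\<lambda>n. LINT t|lborel. causal (\<lambda>t. exp (- of_real (z n) * of_real t) * r t) t) \<longlonglongrightarrow> (LINT t|lborel. causal r t)"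
  proof (rule integral_dominated_convergence[where w="\<lambda>t. norm (causal r t)"])
    show m: "causal r \<in> borel_measurable lborel" using r by (rule borel_measurable_integrable)
    have "causal (\<lambda>t. exp (- of_real (z n) * of_real t) * r t) = (\<lambda>t. exp (- of_real (z n) * of_real t) * causal r t)" for n
      by (auto simp: causal_def)
    then show "causal (\<lambda>t. exp (- of_real (z n) * of_real t) * r t) \<in> borel_measurable lborel" for n
      using m by simp
    show "integrable lborel (\<lambda>t. norm (causal r t))" using r by simp
    have "(\<lambda>n. exp (- of_real (z n) * of_real t) * r t) \<longlonglongrightarrow> exp (- of_real 0 * of_real t) * r t" for t
      by (intro tendsto_intros zl)
    then show "AE t in lborel. (\<lambda>n. causal (\<lambda>t. exp (- of_real (z n) * of_real t) * r t) t) \<longlonglongrightarrow> causal r t"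
      by (simp add: causal_def)
    show "AE t in lborel. norm (causal (\<lambda>t. exp (- of_real (z n) * of_real t) * r t) t) \<le> norm (causal r t)" for n
      using z0[of n] by (auto simp: causal_def norm_mult intro!: mult_left_le_one_le)
  qed
  then have "(\<lambda>n. 1 / (of_real (z n powr \<alpha>) - l)) \<longlonglongrightarrow> (LINT t|lborel. causal r t)"
    unfolding laplace_def[symmetric] L[OF z0] .
  moreover have "(\<lambda>n. z n powr \<alpha>) \<longlonglongrightarrow> 0"
    using tendsto_powr'[OF zl tendsto_const[of \<alpha>]] z0 \<alpha> by (simp add: less_imp_le)
  then have "(\<lambda>n. 1 / (of_real (z n powr \<alpha>) - l)) \<longlonglongrightarrow> 1 / (of_real 0 - l)"
    using l by (intro tendsto_intros) auto
  ultimately have "(LINT t|lborel. causal r t) = 1 / (of_real 0 - l)"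
    using LIMSEQ_unique by blast
  then show ?thesis by simp
qed

text \<open>The transforms can be compared only to the right of the growth rate \<open>M\<close> of
  \<open>x\<close>. By injectivity \<open>x\<close> still equals the bounded candidate
  \<open>y\<close> on the whole half-line, and the limit is then read off from
  \<open>y\<close>.\<close>

lemma scalar_solution_tendsto_0:
  assumes \<beta>: "0 < \<beta>" "\<beta> \<le> 1" and l: "\<beta> * pi / 2 < \<bar>Arg l\<bar>"
    and x: "continuous_on {0..} x" and g: "continuous_on {0..} g" "(g \<longlongrightarrow> 0) at_top"
    and eq: "\<And>t. 0 \<le> t \<Longrightarrow> x t = x0 + frac_integral \<beta> (\<lambda>s. l * x s + g s) t"
  shows "(x \<longlongrightarrow> 0) at_top"
proof -
  obtain G where G: "G \<ge> 0" "\<And>t. 0 \<le> t \<Longrightarrow> norm (g t) \<le> G" using continuous_tendsto_bounded[OF g] by blast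
  obtain C M where M: "0 < M" and xB: "\<And>t. 0 \<le> t \<Longrightarrow> norm (x t) \<le> C * exp (M * t)"
    using scalar_solution_growth[OF \<beta>(1) x g(1) G(2) eq] by blast
  have C: "C \<ge> 0" using xB[of 0] order_trans[OF norm_ge_zero, of "x 0" C] by simp
  obtain r where r: "integrable lborel (causal r)"
    "\<And>z. 0 < z \<Longrightarrow> integrable lborel (causal (\<lambda>t. exp (- of_real z * of_real t) * r t))"
    "\<And>z. 0 < z \<Longrightarrow> laplace r (of_real z) = 1 / (of_real (z powr \<beta>) - l)"
    using resolvent_exists[OF \<beta> l] by blast
  have Argl: "Arg l \<noteq> 0"
  proof
    assume "Arg l = 0"
    then have "\<beta> * pi / 2 < 0" using l by simp
    moreover have "0 < \<beta> * pi / 2" using \<beta> by simp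
    ultimately show False by linarith
  qed
  have l0: "l \<noteq> 0" using Argl Arg_zero by auto
  have lp: "of_real p \<noteq> l" if "p > 0" for p using Argl Arg_of_real[of p] that by auto
  \<comment> \<open>The solution of the transformed equation has numerator
    \<open>z powr (\<beta> - 1) * x0 + G'\<close>. Writing \<open>z powr (\<beta> - 1) * x0\<close>
    as \<open>(z powr \<beta> - l) * (x0 / z) + l * x0 / z\<close> splits off the constant
    \<open>x0\<close> and leaves the transform of \<open>w\<close> divided by
    \<open>z powr \<beta> - l\<close>.\<close>
  define w where "w t = l * x0 + g t" for t
  have wc: "continuous_on {0..} w" unfolding w_def by (intro continuous_intros g)
  have wB: "norm (w t) \<le> norm (l * x0) + G" if "0 \<le> t" for t
    unfolding w_def using G(2)[OF that] norm_triangle_ineq[of "l * x0" "g t"] by linarith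
  have wB': "norm (causal w t) \<le> norm (l * x0) + G" for t
    by (rule causal_bound[OF wB]) (use G in auto)
  define k where "k = conv (causal r) (causal w)"
  define y where "y t = x0 + k t" for t
  have "isCont k t" for t
    unfolding k_def using conv_continuous[OF r(1) causal_measurable[OF wc] wB' causal_isCont[OF wc]] .
  then have kc: "continuous_on {0..} k" by (simp add: continuous_at_imp_continuous_on)
  then have yc: "continuous_on {0..} y" unfolding y_def by (intro continuous_intros)
  obtain K where K: "\<And>t. norm (k t) \<le> K" "K \<ge> 0"
  proof
    show "norm (k t) \<le> (LINT u|lborel. norm (causal r u)) * (norm (l * x0) + G)" for t
      unfolding k_def by (rule conv_bound[OF r(1) causal_measurable[OF wc] wB'])
    show "(LINT u|lborel. norm (causal r u)) * (norm (l * x0) + G) \<ge> 0" using G by simp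
  qed
  have yB: "norm (y t) \<le> norm x0 + K" for t
    unfolding y_def using K(1)[of t] norm_triangle_ineq[of x0 "k t"] by linarith
  have "x t + (-1) * y t = 0" if "0 \<le> t" for t
  proof (rule laplace_unique[OF _ _ _ that])
    show "continuous_on {0..} (\<lambda>t. x t + (-1) * y t)" by (intro continuous_intros x yc)
    fix t :: real assume t: "0 \<le> t"
    have "norm (x t + (-1) * y t) \<le> norm (x t) + norm (y t)" using norm_triangle_ineq4[of "x t" "y t"] by simp
    also have "\<dots> \<le> C * exp (M * t) + (norm x0 + K) * 1" using xB[OF t] yB[of t] by simp
    also have "\<dots> \<le> C * exp (M * t) + (norm x0 + K) * exp (M * t)"
      using M t K(2) by (intro add_left_mono mult_left_mono) auto
    finally show "norm (x t + (-1) * y t) \<le> (C + (norm x0 + K)) * exp (M * t)" by (simp add: algebra_simps)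
  next
    fix z assume z: "M < z"
    then have z0: "z > 0" using M by simp
    let ?i = "\<lambda>f. integrable lborel (causal (\<lambda>t. exp (- complex_of_real z * of_real t) * f t))"
    have xi: "?i x" by (rule laplace_integrable[OF x, of C M]) (use xB z in auto)
    have gi: "?i g" by (rule laplace_integrable[OF g(1), of G 0]) (use G z0 in auto)
    have wi: "?i w" by (rule laplace_integrable[OF wc, of "norm (l * x0) + G" 0]) (use wB z0 in auto)
    have ki: "?i k" by (rule laplace_integrable[OF kc, of K 0]) (use K z0 in auto)
    have ci: "?i (\<lambda>_. c)" for c by (rule laplace_integrable[of _ "norm c" 0]) (use z0 in auto)
    have lxi: "?i (\<lambda>t. l * x t)"
    proof (rule laplace_integrable[of _ "norm l * C" M])
      show "norm (l * x t) \<le> norm l * C * exp (M * t)" if "0 \<le> t" for t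
        using mult_left_mono[OF xB[OF that], of "norm l"] by (simp add: norm_mult mult.assoc)
    qed (use z x in \<open>auto intro!: continuous_intros\<close>)
    have lxgi: "?i (\<lambda>t. l * x t + g t)"
    proof (rule laplace_integrable[of _ "norm l * C + G" M])
      fix t :: real assume t: "0 \<le> t"
      have "norm (l * x t + g t) \<le> norm l * (C * exp (M * t)) + G * 1"
        using norm_triangle_ineq[of "l * x t" "g t"] G(2)[OF t] mult_left_mono[OF xB[OF t], of "norm l"] by (simp add: norm_mult)
      also have "\<dots> \<le> norm l * (C * exp (M * t)) + G * exp (M * t)"
        using M t G by (intro add_left_mono mult_left_mono) auto
      finally show "norm (l * x t + g t) \<le> (norm l * C + G) * exp (M * t)" by (simp add: algebra_simps)
    qed (use x g z in \<open>auto intro!: continuous_intros\<close>)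
    have yi: "?i y" by (rule laplace_integrable[OF yc, of "norm x0 + K" 0]) (use yB z0 in auto)
    have myi: "?i (\<lambda>t. (-1) * y t)" by (rule laplace_integrable[of _ "norm x0 + K" 0]) (use yB z0 yc in \<open>auto intro!: continuous_intros\<close>)
    define X where "X = laplace x (of_real z)"
    define G' where "G' = laplace g (of_real z)"
    define Y where "Y = laplace y (of_real z)"
    define p where "p = complex_of_real (z powr \<beta>)"
    define Z where "Z = complex_of_real z"
    have p: "p \<noteq> 0" "p - l \<noteq> 0" and Z: "Z \<noteq> 0" using z0 lp[of "z powr \<beta>"] by (auto simp: p_def Z_def)
    have "X = laplace (\<lambda>t. x0 + frac_integral \<beta> (\<lambda>s. l * x s + g s) t) (of_real z)"
      unfolding X_def by (rule laplace_cong) (rule eq)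
    also have "\<dots> = x0 / Z + of_real (z powr - \<beta>) * (l * X + G')"
      using laplace_add[OF ci laplace_frac_integral(2)[OF \<beta>(1) z0 lxgi], of x0] laplace_frac_integral(1)[OF \<beta>(1) z0 lxgi]
        laplace_add[OF lxi gi] laplace_const[of "of_real z" x0] z0
      by (simp add: X_def G'_def Z_def laplace_cmult)
    also have "of_real (z powr - \<beta>) = 1 / p" by (simp add: p_def powr_minus divide_inverse)
    finally have "X = x0 / Z + 1 / p * (l * X + G')" .
    then have "p * X = p * (x0 / Z) + (l * X + G')" using p(1) by (simp add: field_simps)
    then have XX: "(p - l) * X = p * (x0 / Z) + G'" by (simp add: algebra_simps)
    have "Y = x0 / Z + laplace k (of_real z)"
      unfolding Y_def y_def using laplace_add[OF ci ki, of x0] laplace_const[of "of_real z" x0] z0 by (simp add: Z_def)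
    also have "laplace k (of_real z) = 1 / (p - l) * laplace w (of_real z)"
      unfolding k_def using laplace_conv[OF r(2)[OF z0] wi] r(3)[OF z0] by (simp add: p_def)
    also have "laplace w (of_real z) = l * x0 / Z + G'"
      unfolding w_def using laplace_add[OF ci gi, of "l * x0"] laplace_const[of "of_real z" "l * x0"] z0 by (simp add: Z_def G'_def)
    finally have "(p - l) * Y = (p - l) * (x0 / Z) + (l * x0 / Z + G')" using p(2) by (simp add: distrib_left)
    also have "\<dots> = p * (x0 / Z) + G'"
    proof -
      have "l * x0 / Z = l * (x0 / Z)" by simp
      then show ?thesis by (simp only: left_diff_distrib) simp
    qed
    finally have "(p - l) * Y = p * (x0 / Z) + G'" .
    then have "X = Y" using XX p(2) by (metis mult_cancel_left)
    then show "laplace (\<lambda>t. x t + (-1) * y t) (of_real z) = 0"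
      unfolding laplace_add[OF xi myi] laplace_cmult by (simp add: X_def Y_def)
  qed
  then have xy: "y t = x t" if "0 \<le> t" for t using that by simp
  have "(w \<longlongrightarrow> l * x0 + 0) at_top" unfolding w_def by (intro tendsto_intros g)
  then have "(k \<longlongrightarrow> (LINT t|lborel. causal r t) * (l * x0)) at_top"
    unfolding k_def by (intro conv_tendsto_at_top[OF r(1) causal_measurable[OF wc] wB'] causal_tendsto) simp
  then have "(y \<longlongrightarrow> x0 + (LINT t|lborel. causal r t) * (l * x0)) at_top"
    unfolding y_def by (intro tendsto_intros)
  then have "(y \<longlongrightarrow> 0) at_top" using resolvent_total_mass[OF \<beta>(1) r(1,3) l0] l0 by simp
  then show ?thesis
    by (rule Lim_transform_eventually) (use xy in \<open>auto simp: eventually_at_top_linorder\<close>)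
qed

section \<open>Instability\<close>

lemma caputo_solution_component:
  fixes x :: "real \<Rightarrow> complex ^ 'd::{finite,linorder}"
  assumes "is_caputo_solution \<alpha> a x0 x"
  shows "continuous_on {0..} (\<lambda>t. x t $ i)"
    and "0 \<le> t \<Longrightarrow> x t $ i = x0 $ i + frac_integral (\<alpha> i) (\<lambda>s. \<Sum>j\<in>{i..}. a i j * x s $ j) t"
  using assms unfolding is_caputo_solution_def by (auto intro!: continuous_intros)

lemma sum_atLeast_split:
  fixes i :: "'d::{finite,linorder}" and f :: "'d \<Rightarrow> complex"
  shows "(\<Sum>j\<in>{i..}. f j) = f i + (\<Sum>j\<in>{i<..}. f j)"
proof -
  have "{i..} = insert i {i<..}" by auto
  then show ?thesis by simp
qed

lemma downward_induct:
  fixes i :: "'d::{finite,linorder}"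
  assumes "\<And>i. (\<And>j. i < j \<Longrightarrow> P j) \<Longrightarrow> P i"
  shows "P i"
proof (induction "card {i<..}" arbitrary: i rule: less_induct)
  case less
  show ?case
  proof (rule assms)
    fix j assume "i < j"
    then have "{j<..} \<subset> {i<..}" by force
    then have "card {j<..} < card {i<..}" by (intro psubset_card_mono) auto
    then show "P j" by (rule less)
  qed
qed

lemma caputo_solution_tendsto_0:
  fixes \<alpha> :: "'d::{finite,linorder} \<Rightarrow> real"
  assumes \<alpha>: "\<And>i. 0 < \<alpha> i \<and> \<alpha> i \<le> 1" and stable: "\<And>i. \<alpha> i * pi / 2 < \<bar>Arg (a i i)\<bar>"
    and x: "is_caputo_solution \<alpha> a x0 x"
  shows "(x \<longlongrightarrow> 0) at_top"
proof -
  have "((\<lambda>t. x t $ i) \<longlongrightarrow> 0) at_top" for i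
  proof (induction i rule: downward_induct)
    case (1 i)
    define g where "g s = (\<Sum>j\<in>{i<..}. a i j * x s $ j)" for s
    have "(g \<longlongrightarrow> (\<Sum>j\<in>{i<..}. a i j * 0)) at_top"
      unfolding g_def by (intro tendsto_intros 1) simp
    then have g: "(g \<longlongrightarrow> 0) at_top" by simp
    have gc: "continuous_on {0..} g" unfolding g_def
      by (intro continuous_intros caputo_solution_component(1)[OF x])
    show ?case
    proof (rule scalar_solution_tendsto_0[OF _ _ stable[of i] caputo_solution_component(1)[OF x] gc g])
      show "x t $ i = x0 $ i + frac_integral (\<alpha> i) (\<lambda>s. a i i * x s $ i + g s) t" if "0 \<le> t" for t
        using caputo_solution_component(2)[OF x that, of i] by (simp add: sum_atLeast_split g_def)
    qed (use \<alpha> in auto)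
  qed
  then show ?thesis by (intro vec_tendstoI) simp
qed

text \<open>The hypothesis \<open>above\<close> keeps the diagonal entries of the later rows off the
  positive reals. At real arguments the factors \<open>z powr \<alpha> j - a j j\<close> can
  therefore be divided out of these rows, which carry zero initial values. Boundedness makes the
  transform of component \<open>k\<close> holomorphic on the right half-plane, so its identity
  extends from the positive reals.\<close>

lemma axis_solution_laplace:
  fixes \<alpha> :: "'d::{finite,linorder} \<Rightarrow> real"
  assumes \<alpha>: "\<And>i. 0 < \<alpha> i" and x: "is_caputo_solution \<alpha> a (axis k 1) x"
    and B: "\<And>t. 0 \<le> t \<Longrightarrow> norm (x t) \<le> B" and above: "\<And>j. k < j \<Longrightarrow> Arg (a j j) \<noteq> 0"
    and s: "0 < Re s"
  shows "(s powr of_real (\<alpha> k) - a k k) * laplace (\<lambda>t. x t $ k) s = s powr of_real (\<alpha> k - 1)"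
proof -
  note xc = caputo_solution_component(1)[OF x] and xeq = caputo_solution_component(2)[OF x]
  have xB: "norm (x t $ i) \<le> B" if "0 \<le> t" for t i
    using B[OF that] Finite_Cartesian_Product.norm_nth_le[of "x t" i] by linarith
  define X where "X i z = laplace (\<lambda>t. x t $ i) (complex_of_real z)" for i z
  have eq: "of_real (z powr \<alpha> i) * X i z = of_real (z powr \<alpha> i) * (axis k 1 $ i / of_real z) + (\<Sum>j\<in>{i..}. a i j * X j z)"
    if z: "0 < z" for z i
  proof -
    let ?i = "\<lambda>f. integrable lborel (causal (\<lambda>t. exp (- complex_of_real z * of_real t) * f t))"
    have ci: "?i (\<lambda>_. c)" for c by (rule laplace_integrable[of _ "norm c" 0]) (use z in auto)
    have xi: "?i (\<lambda>t. a i j * x t $ j)" for j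
    proof (rule laplace_integrable[of _ "norm (a i j) * B" 0])
      show "norm (a i j * x t $ j) \<le> norm (a i j) * B * exp (0 * t)" if "0 \<le> t" for t
        using xB[OF that, of j] by (simp add: norm_mult mult_left_mono)
    qed (use z in \<open>auto intro!: continuous_intros xc\<close>)
    have si: "?i (\<lambda>t. \<Sum>j\<in>{i..}. a i j * x t $ j)"
    proof (rule laplace_integrable[of _ "\<Sum>j\<in>{i..}. norm (a i j) * B" 0])
      show "norm (\<Sum>j\<in>{i..}. a i j * x t $ j) \<le> (\<Sum>j\<in>{i..}. norm (a i j) * B) * exp (0 * t)" if "0 \<le> t" for t
        using xB[OF that] by (auto intro!: sum_norm_le mult_left_mono simp: norm_mult)
    qed (use z in \<open>auto intro!: continuous_intros xc\<close>)
    have "X i z = laplace (\<lambda>t. axis k 1 $ i + frac_integral (\<alpha> i) (\<lambda>s. \<Sum>j\<in>{i..}. a i j * x s $ j) t) (of_real z)"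
      unfolding X_def by (rule laplace_cong) (rule xeq)
    also have "\<dots> = axis k 1 $ i / of_real z + of_real (z powr - \<alpha> i) * (\<Sum>j\<in>{i..}. a i j * X j z)"
      unfolding laplace_add[OF ci laplace_frac_integral(2)[OF \<alpha> z si]] laplace_frac_integral(1)[OF \<alpha> z si]
        laplace_sum[OF xi] laplace_cmult X_def
      using laplace_const[of "of_real z" "axis k 1 $ i"] z by simp
    also have "complex_of_real (z powr - \<alpha> i) = 1 / of_real (z powr \<alpha> i)" by (simp add: powr_minus divide_inverse)
    finally show ?thesis using z by (simp add: field_simps)
  qed
  have X0: "k < i \<longrightarrow> (\<forall>z>0. X i z = 0)" for i
  proof (induction i rule: downward_induct)
    case (1 i)
    show ?case
    proof (intro impI allI)
      fix z :: real assume i: "k < i" and z: "0 < z"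
      have "(\<Sum>j\<in>{i..}. a i j * X j z) = a i i * X i z"
        unfolding sum_atLeast_split using 1 i z by (simp add: sum.neutral)
      then have "(of_real (z powr \<alpha> i) - a i i) * X i z = 0"
        using eq[OF z, of i] i by (simp add: axis_def left_diff_distrib)
      moreover have "of_real (z powr \<alpha> i) \<noteq> a i i"
      proof -
        have "Arg (of_real (z powr \<alpha> i)) = 0" using Arg_of_real[of "z powr \<alpha> i"] z by simp
        then show ?thesis using above[OF i] by metis
      qed
      ultimately show "X i z = 0" by simp
    qed
  qed
  define F where "F s = (s powr of_real (\<alpha> k) - a k k) * laplace (\<lambda>t. x t $ k) s - s powr of_real (\<alpha> k - 1)" for s
  have "F s = 0"
  proof (rule analytic_continuation[of F "{s. 0 < Re s}" "of_real ` {0<..}" 1 s])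
    show "F holomorphic_on {s. 0 < Re s}"
      unfolding F_def by (intro holomorphic_intros laplace_holomorphic[OF xc xB]) (auto simp: complex_nonpos_Reals_iff)
    show "open {s. 0 < Re s}" by (rule open_halfspace_Re_gt)
    show "connected {s. 0 < Re s}" by (intro convex_connected convex_halfspace_Re_gt)
    show "1 islimpt (of_real ` {0<..} :: complex set)"
      unfolding islimpt_approachable
    proof (intro allI impI)
      fix e :: real assume "e > 0"
      then have "of_real (1 + e/2) \<noteq> (1::complex) \<and> dist (of_real (1 + e/2)) (1::complex) < e"
        by (simp add: dist_norm)
      moreover have "complex_of_real (1 + e/2) \<in> of_real ` {0<..}"
        by (rule imageI) (use \<open>e > 0\<close> in simp)
      ultimately show "\<exists>x'\<in>of_real ` {0<..}. x' \<noteq> 1 \<and> dist x' (1::complex) < e" by blast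
    qed
    show "F w = 0" if w: "w \<in> of_real ` {0<..}" for w
    proof -
      obtain z where z: "0 < z" "w = of_real z" using w by auto
      have "(\<Sum>j\<in>{k..}. a k j * X j z) = a k k * X k z"
        unfolding sum_atLeast_split using X0 z by (simp add: sum.neutral)
      then have "(of_real (z powr \<alpha> k) - a k k) * X k z = of_real (z powr \<alpha> k / z)"
        using eq[OF z(1), of k] by (simp add: axis_def left_diff_distrib)
      moreover have "z powr \<alpha> k / z = z powr (\<alpha> k - 1)" using z by (simp add: powr_diff)
      ultimately show ?thesis
        using z by (simp add: F_def X_def powr_of_real flip: of_real_diff)
    qed
  qed (use s in auto)
  then show ?thesis by (simp add: F_def)
qed

text \<open>The imaginary part of \<open>Ln a / of_real \<beta>\<close> is
  \<open>Arg a / \<beta>\<close>, of modulus at most pi / 2. It stays within the principal branch,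
  so \<open>Ln\<close> recovers it from \<open>s0\<close>, and the sign of \<open>Re s0\<close> is
  that of \<open>cos (Arg a / \<beta>)\<close>.\<close>

lemma frac_root_powr:
  assumes "0 < \<beta>" "a \<noteq> 0" "\<bar>Arg a\<bar> \<le> \<beta> * pi / 2"
  defines "s0 \<equiv> exp (Ln a / of_real \<beta>)"
  shows "s0 powr of_real \<beta> = a" and "s0 \<noteq> 0" and "s0 \<notin> \<real>\<^sub>\<le>\<^sub>0"
    and "\<bar>Arg a\<bar> < \<beta> * pi / 2 \<Longrightarrow> 0 < Re s0" and "\<bar>Arg a\<bar> = \<beta> * pi / 2 \<Longrightarrow> Re s0 = 0"
proof -
  have Im: "Im (Ln a / of_real \<beta>) = Arg a / \<beta>" using assms(2) by (simp add: Arg_def)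
  have ab: "\<bar>Arg a / \<beta>\<bar> \<le> pi / 2" using assms by (simp add: abs_divide field_simps)
  have Lns0: "Ln s0 = Ln a / of_real \<beta>"
    unfolding s0_def by (rule Ln_exp) (use Im ab pi_gt_zero in linarith)+
  show "s0 \<noteq> 0" by (simp add: s0_def)
  then have "s0 powr of_real \<beta> = exp (of_real \<beta> * (Ln a / of_real \<beta>))"
    unfolding powr_def Lns0 by (simp only: if_False)
  then show "s0 powr of_real \<beta> = a" using assms(1,2) by simp
  have Re: "Re s0 = exp (Re (Ln a / of_real \<beta>)) * cos (Arg a / \<beta>)"
    unfolding s0_def Re_exp Im ..
  have c: "cos (Arg a / \<beta>) = cos (\<bar>Arg a\<bar> / \<beta>)" using cos_abs_real[of "Arg a / \<beta>"] assms by simp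
  show "0 < Re s0" if "\<bar>Arg a\<bar> < \<beta> * pi / 2"
  proof -
    have "\<bar>Arg a\<bar> / \<beta> < pi / 2" using that assms by (simp add: field_simps)
    then have "0 < cos (\<bar>Arg a\<bar> / \<beta>)" using assms(1) pi_gt_zero
      by (intro cos_gt_zero_pi) (auto intro: less_le_trans[of _ 0])
    then show ?thesis by (simp add: Re c)
  qed
  show "Re s0 = 0" if "\<bar>Arg a\<bar> = \<beta> * pi / 2"
  proof -
    have "\<bar>Arg a\<bar> / \<beta> = pi / 2" using that assms by (simp add: field_simps)
    then show ?thesis unfolding Re c by (simp only: cos_pi_half mult_zero_right)
  qed
  show "s0 \<notin> \<real>\<^sub>\<le>\<^sub>0"
  proof
    assume "s0 \<in> \<real>\<^sub>\<le>\<^sub>0"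
    then have "Im (Ln s0) = pi" using \<open>s0 \<noteq> 0\<close> by (auto simp: complex_nonpos_Reals_iff Im_Ln_eq_pi complex_eq_iff)
    then show False using Lns0 Im ab pi_gt_zero by simp
  qed
qed

text \<open>An Abelian estimate: past a time \<open>T\<close> with
  \<open>norm (f t) \<le> \<delta>\<close> the integral contributes at most
  \<open>\<delta> / \<epsilon>\<close>, before it at most \<open>B * T\<close>. After multiplication
  by \<epsilon> only \<delta> survives in the limit.\<close>

lemma laplace_boundary_small:
  assumes f: "continuous_on {0..} f" "(f \<longlongrightarrow> 0) at_top" and s0: "Re s0 = 0"
    and e: "\<And>n. 0 < e n" "e \<longlonglongrightarrow> 0"
  shows "(\<lambda>n. of_real (e n) * laplace f (s0 + of_real (e n))) \<longlonglongrightarrow> 0"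
proof -
  obtain B where B: "B \<ge> 0" "\<And>t. 0 \<le> t \<Longrightarrow> norm (f t) \<le> B" using continuous_tendsto_bounded[OF f] by blast
  have bound: "norm (of_real \<epsilon> * laplace f (s0 + of_real \<epsilon>)) \<le> \<delta> + \<epsilon> * (B * T)"
    if \<epsilon>: "0 < \<epsilon>" and T: "0 \<le> T" "\<And>t. T \<le> t \<Longrightarrow> norm (f t) \<le> \<delta>" for \<epsilon> \<delta> T
  proof -
    have d: "\<delta> \<ge> 0" using T(2)[of T] order_trans[OF norm_ge_zero] by blast
    define n where "n t = norm (causal (\<lambda>t. exp (of_real (- \<epsilon>) * of_real t)) t)" for t
    have ni: "integrable lborel n" unfolding n_def
      by (intro integrable_norm causal_exp_integrable) (use \<epsilon> in auto)
    have nI: "(LINT t|lborel. n t) = 1 / \<epsilon>"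
      unfolding n_def using causal_exp_norm_integral[of "of_real (- \<epsilon>)"] \<epsilon> by simp
    have ii: "integrable lborel (\<lambda>t. B * indicator {0..T} t)"
      by (intro integrable_mult_right integrable_real_indicator) (use T in auto)
    have "norm (laplace f (s0 + of_real \<epsilon>)) \<le> (LINT t|lborel. \<delta> * n t + B * indicator {0..T} t)"
      unfolding laplace_def
    proof (rule Bochner_Integration.integral_norm_bound_integral)
      show "integrable lborel (causal (\<lambda>t. exp (- (s0 + of_real \<epsilon>) * of_real t) * f t))"
        by (rule laplace_integrable[OF f(1), of B 0]) (use B \<epsilon> s0 in auto)
      show "integrable lborel (\<lambda>t. \<delta> * n t + B * indicator {0..T} t)" using ni ii by simp
      fix t
      show "norm (causal (\<lambda>t. exp (- (s0 + of_real \<epsilon>) * of_real t) * f t) t) \<le> \<delta> * n t + B * indicator {0..T} t"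
      proof (cases "0 \<le> t")
        case True
        have "norm (causal (\<lambda>t. exp (- (s0 + of_real \<epsilon>) * of_real t) * f t) t) = exp (- \<epsilon> * t) * norm (f t)"
          using True s0 by (simp add: causal_def norm_mult)
        also have "\<dots> \<le> \<delta> * exp (- \<epsilon> * t) + B * indicator {0..T} t"
        proof (cases "t \<le> T")
          case True': True
          have "exp (- \<epsilon> * t) * norm (f t) \<le> 1 * B" using True \<epsilon> B by (intro mult_mono) auto
          moreover have "0 \<le> \<delta> * exp (- \<epsilon> * t)" using d by simp
          ultimately show ?thesis using True True' by simp
        next
          case False
          then show ?thesis using T(2)[of t] by (simp add: mult.commute mult_right_mono)
        qed
        also have "exp (- \<epsilon> * t) = n t" using True by (simp add: n_def causal_def)
        finally show ?thesis .
      qed (use d in \<open>simp add: causal_def n_def\<close>)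
    qed
    also have "\<dots> = \<delta> / \<epsilon> + B * T" using ni ii nI T by (subst Bochner_Integration.integral_add) auto
    finally have "\<epsilon> * norm (laplace f (s0 + of_real \<epsilon>)) \<le> \<epsilon> * (\<delta> / \<epsilon> + B * T)" using \<epsilon> by simp
    then show ?thesis using \<epsilon> by (simp add: norm_mult distrib_left)
  qed
  show ?thesis
  proof (rule LIMSEQ_I)
    fix \<eta> :: real assume \<eta>: "0 < \<eta>"
    have "eventually (\<lambda>t. dist (f t) 0 < \<eta> / 2) at_top" using f(2) by (rule tendstoD) (use \<eta> in simp)
    then obtain T0 where T0: "\<And>t. T0 \<le> t \<Longrightarrow> norm (f t) < \<eta> / 2" by (auto simp: eventually_at_top_linorder)
    define T where "T = max T0 0"
    have T: "0 \<le> T" "\<And>t. T \<le> t \<Longrightarrow> norm (f t) \<le> \<eta> / 2" using T0 by (auto simp: T_def less_imp_le)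
    have "(\<lambda>n. \<eta> / 2 + e n * (B * T)) \<longlonglongrightarrow> \<eta> / 2 + 0 * (B * T)" by (intro tendsto_intros e)
    then have "eventually (\<lambda>n. \<eta> / 2 + e n * (B * T) < \<eta>) sequentially"
      by (rule order_tendstoD) (use \<eta> in simp)
    then have "eventually (\<lambda>n. norm (of_real (e n) * laplace f (s0 + of_real (e n)) - 0) < \<eta>) sequentially"
      by eventually_elim (use bound[OF e(1) T] in \<open>auto intro: le_less_trans\<close>)
    then show "\<exists>no. \<forall>n\<ge>no. norm (of_real (e n) * laplace f (s0 + of_real (e n)) - 0) < \<eta>"
      by (simp add: eventually_sequentially)
  qed
qed

lemma axis_solution_unbounded:
  fixes \<alpha> :: "'d::{finite,linorder} \<Rightarrow> real"
  assumes \<alpha>: "\<And>i. 0 < \<alpha> i" and x: "is_caputo_solution \<alpha> a (axis k 1) x"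
    and k: "a k k \<noteq> 0" "\<bar>Arg (a k k)\<bar> < \<alpha> k * pi / 2" and above: "\<And>j. k < j \<Longrightarrow> Arg (a j j) \<noteq> 0"
  shows "\<not> bounded (x ` {0..})"
proof
  assume "bounded (x ` {0..})"
  then obtain B where B: "\<And>t. 0 \<le> t \<Longrightarrow> norm (x t) \<le> B" unfolding bounded_iff by auto
  define s0 where "s0 = exp (Ln (a k k) / of_real (\<alpha> k))"
  note s0 = frac_root_powr[OF \<alpha> k(1) less_imp_le[OF k(2)], folded s0_def]
  have "(s0 powr of_real (\<alpha> k) - a k k) * laplace (\<lambda>t. x t $ k) s0 = s0 powr of_real (\<alpha> k - 1)"
    by (rule axis_solution_laplace[OF \<alpha> x B above s0(4)[OF k(2)]])
  then show False using s0(1,2) by simp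
qed

text \<open>On the boundary a solution may be bounded, as \<open>exp (\<i> * t)\<close> shows for
  order 1, so convergence itself has to be refuted. The zero of \<open>s powr \<alpha> - a\<close>
  at \<open>s0\<close> costs one factor \<open>e n\<close>: divided by it, the left factor tends to
  the derivative at \<open>s0\<close>, finite because \<open>s0\<close> avoids the branch cut. Small
  \<open>e n * X (s n)\<close> then forces the limit 0, while the right side tends to a nonzero
  power of \<open>s0\<close>.\<close>

lemma axis_solution_not_tendsto_0:
  fixes \<alpha> :: "'d::{finite,linorder} \<Rightarrow> real"
  assumes \<alpha>: "\<And>i. 0 < \<alpha> i" and x: "is_caputo_solution \<alpha> a (axis k 1) x"
    and k: "a k k \<noteq> 0" "\<bar>Arg (a k k)\<bar> = \<alpha> k * pi / 2" and above: "\<And>j. k < j \<Longrightarrow> Arg (a j j) \<noteq> 0"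
  shows "\<not> (x \<longlongrightarrow> 0) at_top"
proof
  assume lim: "(x \<longlongrightarrow> 0) at_top"
  have xc: "continuous_on {0..} x" using x by (simp add: is_caputo_solution_def)
  obtain B where B: "\<And>t. 0 \<le> t \<Longrightarrow> norm (x t) \<le> B" using continuous_tendsto_bounded[OF xc lim] by blast
  define s0 where "s0 = exp (Ln (a k k) / of_real (\<alpha> k))"
  note s0 = frac_root_powr[OF \<alpha> k(1) eq_refl[OF k(2)], folded s0_def]
  note Re0 = s0(5)[OF k(2)]
  define X where "X = laplace (\<lambda>t. x t $ k)"
  define e where "e n = 1 / real (Suc n)" for n
  have e: "0 < e n" for n by (simp add: e_def)
  have el: "e \<longlonglongrightarrow> 0" unfolding e_def by (rule LIMSEQ_Suc[OF lim_1_over_n])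
  define s where "s n = s0 + of_real (e n)" for n
  have sl: "s \<longlonglongrightarrow> s0" unfolding s_def using tendsto_add[OF tendsto_const[of s0] tendsto_of_real[OF el]] by simp
  have sne: "s n \<noteq> s0" for n using e[of n] by (simp add: s_def)
  have id: "(s n powr of_real (\<alpha> k) - a k k) * X (s n) = s n powr of_real (\<alpha> k - 1)" for n
    unfolding X_def by (rule axis_solution_laplace[OF \<alpha> x B above]) (use Re0 e in \<open>auto simp: s_def\<close>)
  have "((\<lambda>t. x t $ k) \<longlongrightarrow> 0 $ k) at_top" by (intro tendsto_intros lim)
  then have small: "(\<lambda>n. of_real (e n) * X (s n)) \<longlonglongrightarrow> 0"
    unfolding X_def s_def
    by (intro laplace_boundary_small[OF caputo_solution_component(1)[OF x] _ Re0 e el]) simp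
  have "((\<lambda>s. s powr of_real (\<alpha> k)) has_field_derivative of_real (\<alpha> k) * s0 powr (of_real (\<alpha> k) - 1)) (at s0)"
    by (rule has_field_derivative_powr[OF s0(3)])
  then have "((\<lambda>s. (s powr of_real (\<alpha> k) - a k k) / (s - s0)) \<longlongrightarrow> of_real (\<alpha> k) * s0 powr (of_real (\<alpha> k) - 1)) (at s0)"
    by (simp add: has_field_derivative_iff s0(1))
  then have "((\<lambda>s. (s powr of_real (\<alpha> k) - a k k) / (s - s0)) \<circ> s) \<longlonglongrightarrow> of_real (\<alpha> k) * s0 powr (of_real (\<alpha> k) - 1)"
    using sl sne unfolding tendsto_at_iff_sequentially by blast
  then have "(\<lambda>n. ((\<lambda>s. (s powr of_real (\<alpha> k) - a k k) / (s - s0)) \<circ> s) n * (of_real (e n) * X (s n))) \<longlonglongrightarrow>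
      of_real (\<alpha> k) * s0 powr (of_real (\<alpha> k) - 1) * 0"
    by (rule tendsto_mult[OF _ small])
  moreover have "((\<lambda>s. (s powr of_real (\<alpha> k) - a k k) / (s - s0)) \<circ> s) n * (of_real (e n) * X (s n)) = s n powr of_real (\<alpha> k - 1)" for n
    using id[of n] e[of n] by (simp add: s_def)
  ultimately have "(\<lambda>n. s n powr of_real (\<alpha> k - 1)) \<longlonglongrightarrow> 0" by simp
  moreover have "(\<lambda>n. s n powr of_real (\<alpha> k - 1)) \<longlonglongrightarrow> s0 powr of_real (\<alpha> k - 1)"
    by (intro tendsto_powr_complex sl tendsto_const s0(3))
  ultimately have "s0 powr of_real (\<alpha> k - 1) = 0" using LIMSEQ_unique by blast
  then show False using s0(2) by simp
qed

section \<open>The largest violating index and the two claims\<close>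

lemma max_index:
  fixes P :: "'d::{finite,linorder} \<Rightarrow> bool"
  assumes "P i"
  shows "\<exists>k. P k \<and> (\<forall>j>k. \<not> P j)"
proof (intro exI conjI allI impI notI)
  have "Max {i. P i} \<in> {i. P i}" using assms by (intro Max_in) auto
  then show "P (Max {i. P i})" by simp
  fix j assume j: "Max {i. P i} < j" "P j"
  then have "j \<le> Max {i. P i}" by (intro Max_ge) auto
  then show False using j(1) by (blast dest: leD)
qed

theorem theorem3p1:
  fixes \<alpha> :: "'d::{finite,linorder} \<Rightarrow> real"
    and a :: "'d \<Rightarrow> 'd \<Rightarrow> complex"
  assumes alpha: "\<And>i. 0 < \<alpha> i \<and> \<alpha> i \<le> 1"
    and diag: "\<And>i. a i i \<noteq> 0"
  shows "((\<forall>x0 x. is_caputo_solution \<alpha> a x0 x \<longrightarrow> (x \<longlongrightarrow> 0) at_top) \<longleftrightarrow>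
            (\<forall>k. \<bar>Arg (a k k)\<bar> > \<alpha> k * pi / 2)) \<and>
         ((\<exists>k. \<bar>Arg (a k k)\<bar> < \<alpha> k * pi / 2) \<longrightarrow>
            (\<exists>x0. (\<exists>x. is_caputo_solution \<alpha> a x0 x) \<and>
                  (\<forall>x. is_caputo_solution \<alpha> a x0 x \<longrightarrow> \<not> bounded (x ` {0..}))))"
proof (intro conjI iffI impI allI)
  have \<alpha>: "0 < \<alpha> i" for i using alpha by simp
  \<comment> \<open>An argument equal to 0 is itself a strict violation, so indices without strict
    violation satisfy the hypothesis \<open>above\<close> of the instability lemmas.\<close>
  have Arg0: "Arg (a j j) \<noteq> 0" if "\<not> \<bar>Arg (a j j)\<bar> < \<alpha> j * pi / 2" for j
  proof
    assume "Arg (a j j) = 0"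
    moreover have "0 < \<alpha> j * pi / 2" using \<alpha>[of j] by simp
    ultimately show False using that by simp
  qed
  show unbounded: "\<exists>x0. (\<exists>x. is_caputo_solution \<alpha> a x0 x) \<and>
      (\<forall>x. is_caputo_solution \<alpha> a x0 x \<longrightarrow> \<not> bounded (x ` {0..}))"
    if ex: "\<exists>k. \<bar>Arg (a k k)\<bar> < \<alpha> k * pi / 2"
  proof -
    obtain k where k: "\<bar>Arg (a k k)\<bar> < \<alpha> k * pi / 2" "\<And>j. k < j \<Longrightarrow> \<not> \<bar>Arg (a j j)\<bar> < \<alpha> j * pi / 2"
      using ex max_index[of "\<lambda>k. \<bar>Arg (a k k)\<bar> < \<alpha> k * pi / 2"] by blast
    have "\<forall>x. is_caputo_solution \<alpha> a (axis k 1) x \<longrightarrow> \<not> bounded (x ` {0..})"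
      using axis_solution_unbounded[of \<alpha> a k, OF \<alpha> _ diag k(1) Arg0[OF k(2)]] by blast
    then show ?thesis using caputo_solution_exists[of \<alpha> a "axis k 1", OF \<alpha>] by blast
  qed
  show "\<alpha> k * pi / 2 < \<bar>Arg (a k k)\<bar>"
    if conv: "\<forall>x0 x. is_caputo_solution \<alpha> a x0 x \<longrightarrow> (x \<longlongrightarrow> 0) at_top" for k
  proof (rule ccontr)
    assume k: "\<not> \<alpha> k * pi / 2 < \<bar>Arg (a k k)\<bar>"
    \<comment> \<open>Strict violations are excluded at every index first, since a convergent
      continuous solution is bounded. What remains at \<open>k\<close> is equality, and
      \<open>above\<close> holds for this \<open>k\<close> even if it is not the largest such
      index.\<close>
    have "\<not> \<bar>Arg (a j j)\<bar> < \<alpha> j * pi / 2" for j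
    proof
      assume "\<bar>Arg (a j j)\<bar> < \<alpha> j * pi / 2"
      then obtain x0 x where x: "is_caputo_solution \<alpha> a x0 x" "\<not> bounded (x ` {0..})"
        using unbounded by blast
      have "continuous_on {0..} x" "(x \<longlongrightarrow> 0) at_top"
        using x conv by (auto simp: is_caputo_solution_def)
      then obtain B where "\<And>t. 0 \<le> t \<Longrightarrow> norm (x t) \<le> B" by (rule continuous_tendsto_bounded) blast
      then show False using x(2) by (auto simp: bounded_iff)
    qed
    note none = this
    obtain x where x: "is_caputo_solution \<alpha> a (axis k 1) x" using caputo_solution_exists[of \<alpha> a "axis k 1", OF \<alpha>] by blast
    have "\<bar>Arg (a k k)\<bar> = \<alpha> k * pi / 2" using k none[of k] by linarith
    then have "\<not> (x \<longlongrightarrow> 0) at_top"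
      using axis_solution_not_tendsto_0[of \<alpha> a k x, OF \<alpha> x diag _ Arg0[OF none]] by blast
    then show False using conv x by blast
  qed
  show "(x \<longlongrightarrow> 0) at_top"
    if "\<forall>k. \<alpha> k * pi / 2 < \<bar>Arg (a k k)\<bar>" "is_caputo_solution \<alpha> a x0 x" for x0 x
    using caputo_solution_tendsto_0[OF alpha _ that(2)] that(1) by blast
qed

end
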